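(* Let $(M,g)$ be an $n$-dimensional Riemannian manifold ($n\ge 3$), $(B,g_B)$ a Riemannian vector bundle over $M$ of rank $m-n$, and $\zeta$ a $B$-valued symmetric $(1,2)$-tensor field on $M$. Let $T$ be a curvature-like tensor field on $M$ satisfying the algebraic Gauss equation $$T(X,Y,Z,W)=g_B(\zeta(X,W),\zeta(Y,Z))-g_B(\zeta(X,Z),\zeta(Y,W))$$ for all vector fields $X,Y,Z,W$ on $M$. Then for every $p\in M$ the $T$-normalized scalar curvature is bounded above by the algebraic Casorati curvature $\delta_{\mathcal C^{T,\zeta}}(n-1)$: $$(\tau_T)_{\rm Nor}(p)\le[\delta_{\mathcal C^{T,\zeta}}(n-1)]_p.$$ Moreover, if $\inf\{\mathcal C^{T,\zeta}(\Pi_{n-1}):\Pi_{n-1}\text{ is a hyperplane of }T_pM\}$ is attained by a hyperplane $\Pi_{n-1}$ of $T_pM$, then equality holds at $p$ if and only if, with respect to a suitable orthonormal basis $\{e_1,\dots,e_n\}$ of $T_pM$ and a suitable orthonormal basis $\{e_{n+1},\dots,e_m\}$ of the fibre $B_p$, the components $\zeta_{ij}^\alpha=g_B(\zeta(e_i,e_j),e_\alpha)$ satisfy $$\zeta_{ij}^\alpha=0\qquad (i,j\in\{1,\dots,n\},\ i\ne j,\ \alpha\in\{n+1,\dots,m\}),$$ $$\zeta_{11}^\alpha=\zeta_{22}^\alpha=\cdots=\zeta_{n-1\,n-1}^\alpha=\frac12\,\zeta_{nn}^\alpha\qquad(\alpha\in\{n+1,\dots,m\}).$$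
   Context: A $B$-valued symmetric $(1,2)$-tensor field $\zeta$ on $M$ assigns to each $p$ a symmetric bilinear map $T_pM\times T_pM\to B_p$. A curvature-like tensor field is a $(0,4)$-tensor field $T$ with $T(X,Y,Z,W)=-T(Y,X,Z,W)$, $T(X,Y,Z,W)=T(Z,W,X,Y)$ and $T(X,Y,Z,W)+T(Y,Z,X,W)+T(Z,X,Y,W)=0$. The $T$-scalar curvature at $p$ is $\tau_T(p)=\sum_{1\le i<j\le n}T(e_i,e_j,e_j,e_i)$ for any orthonormal basis $\{e_1,\dots,e_n\}$ of $T_pM$, and the $T$-normalized scalar curvature is $(\tau_T)_{\rm Nor}(p)=\frac{2}{n(n-1)}\tau_T(p)$. For a $k$-dimensional subspace $\Pi_k\subset T_pM$, $k\ge2$, with orthonormal basis $\{e_1,\dots,e_k\}$ and an orthonormal basis $\{e_{n+1},\dots,e_m\}$ of $B_p$, the algebraic Casorati curvature of $\Pi_k$ is $\mathcal C^{T,\zeta}(\Pi_k)=\frac1k\sum_{\alpha=n+1}^m\sum_{i,j=1}^k(\zeta_{ij}^\alpha)^2$, where $\zeta_{ij}^\alpha=g_B(\zeta(e_i,e_j),e_\alpha)$. Put $\mathcal C^{T,\zeta}_p=\mathcal C^{T,\zeta}(T_pM)=\frac1n\|\zeta\|^2$ at $p$. A hyperplane of $T_pM$ is an $(n-1)$-dimensional linear subspace. The algebraic Casorati curvature $\delta_{\mathcal C^{T,\zeta}}(n-1)$ is defined by $$[\delta_{\mathcal C^{T,\zeta}}(n-1)]_p=\frac12\,\mathcal C_p^{T,\zeta}+\frac{n+1}{2n}\inf\{\mathcal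 C^{T,\zeta}(\Pi_{n-1}):\Pi_{n-1}\text{ a hyperplane of }T_pM\}.$$ *)

theory Defs
  imports "HOL-Analysis.Analysis"
begin

section \<open>Smooth manifolds\<close>

primrec Ck_on :: "nat \<Rightarrow> 'e::euclidean_space set \<Rightarrow> ('e \<Rightarrow> 'f::real_normed_vector) \<Rightarrow> bool" where
  "Ck_on 0 S f \<longleftrightarrow> continuous_on S f"
| "Ck_on (Suc k) S f \<longleftrightarrow>
     (\<forall>x\<in>S. f differentiable (at x)) \<and> (\<forall>v. Ck_on k S (\<lambda>x. frechet_derivative f (at x) v))"

text \<open>Only used for open \<open>S\<close>.\<close>

definition smooth_on :: "'e::euclidean_space set \<Rightarrow> ('e \<Rightarrow> 'f::real_normed_vector) \<Rightarrow> bool" where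
  "smooth_on S f \<longleftrightarrow> (\<forall>k. Ck_on k S f)"

text \<open>A chart is a pair of a domain and a coordinate map; the values of the coordinate map outside
  the domain are irrelevant.\<close>

type_synonym ('a, 'n) chart = "'a set \<times> ('a \<Rightarrow> real ^ 'n)"

definition is_chart :: "'a topology \<Rightarrow> ('a, 'n::finite) chart \<Rightarrow> bool" where
  "is_chart M c \<longleftrightarrow> openin M (fst c) \<and> open (snd c ` fst c) \<and>
     homeomorphic_map (subtopology M (fst c)) (top_of_set (snd c ` fst c)) (snd c)"

definition chart_inv :: "('a, 'n) chart \<Rightarrow> real ^ 'n \<Rightarrow> 'a" where
  "chart_inv c = inv_into (fst c) (snd c)"

definition transition :: "('a, 'n) chart \<Rightarrow> ('a, 'n) chart \<Rightarrow> real ^ 'n \<Rightarrow> real ^ 'n" where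
  "transition c d = snd d \<circ> chart_inv c"

definition smooth_manifold :: "'a topology \<Rightarrow> ('a, 'n::finite) chart set \<Rightarrow> bool" where
  "smooth_manifold M A \<longleftrightarrow>
     Hausdorff_space M \<and> second_countable M \<and>
     (\<forall>c\<in>A. is_chart M c) \<and> (\<Union>c\<in>A. fst c) = topspace M \<and>
     (\<forall>c\<in>A. \<forall>d\<in>A. smooth_on (snd c ` (fst c \<inter> fst d)) (transition c d))"

definition smooth_fun_on ::
  "('a, 'n::finite) chart set \<Rightarrow> 'a set \<Rightarrow> ('a \<Rightarrow> 'f::real_normed_vector) \<Rightarrow> bool" where
  "smooth_fun_on A W f \<longleftrightarrow> (\<forall>c\<in>A. smooth_on (snd c ` (fst c \<inter> W)) (f \<circ> chart_inv c))"


section \<open>Tangent vectors and tensor fields\<close>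

text \<open>A tangent vector at \<open>p\<close> is given by its components in a reference chart
  \<open>chart_at A p\<close> around \<open>p\<close>, so that every tangent space is modelled on the vector space
  \<open>real ^ 'n\<close>. Its components in another chart are obtained by applying
  the derivative of the transition map. The reference chart may jump
  from point to point, hence smoothness is always tested in the components with respect to a fixed
  chart, and never in terms of the raw values.\<close>

definition chart_at :: "('a, 'n) chart set \<Rightarrow> 'a \<Rightarrow> ('a, 'n) chart" where
  "chart_at A p = (SOME c. c \<in> A \<and> p \<in> fst c)"

definition components ::
  "('a, 'n::finite) chart set \<Rightarrow> ('a, 'n) chart \<Rightarrow> 'a \<Rightarrow> real ^ 'n \<Rightarrow> real ^ 'n" where
  "components A c p v =
     frechet_derivative (transition (chart_at A p) c) (at (snd (chart_at A p) p)) v"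

text \<open>The vector field on the domain of \<open>c\<close> with constant components \<open>u\<close> in \<open>c\<close>; for
  \<open>u = axis i 1\<close> this is the \<open>i\<close>-th coordinate vector field.\<close>

definition coord_field ::
  "('a, 'n::finite) chart set \<Rightarrow> ('a, 'n) chart \<Rightarrow> real ^ 'n \<Rightarrow> 'a \<Rightarrow> real ^ 'n" where
  "coord_field A c u p = frechet_derivative (transition c (chart_at A p)) (at (snd c p)) u"

definition vector_field :: "('a, 'n::finite) chart set \<Rightarrow> ('a \<Rightarrow> real ^ 'n) \<Rightarrow> bool" where
  "vector_field A X \<longleftrightarrow> (\<forall>c\<in>A. smooth_fun_on A (fst c) (\<lambda>p. components A c p (X p)))"

definition inner_product_on :: "'v::real_vector set \<Rightarrow> ('v \<Rightarrow> 'v \<Rightarrow> real) \<Rightarrow> bool" where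
  "inner_product_on V h \<longleftrightarrow>
     (\<forall>x\<in>V. \<forall>y\<in>V. h x y = h y x) \<and>
     (\<forall>x\<in>V. \<forall>y\<in>V. \<forall>z\<in>V. h (x + y) z = h x z + h y z) \<and>
     (\<forall>c. \<forall>x\<in>V. \<forall>y\<in>V. h (c *\<^sub>R x) y = c * h x y) \<and>
     (\<forall>x\<in>V. x \<noteq> 0 \<longrightarrow> h x x > 0)"

definition riemannian_metric ::
  "'a topology \<Rightarrow> ('a, 'n::finite) chart set \<Rightarrow> ('a \<Rightarrow> real ^ 'n \<Rightarrow> real ^ 'n \<Rightarrow> real) \<Rightarrow> bool" where
  "riemannian_metric M A g \<longleftrightarrow>
     (\<forall>p\<in>topspace M. inner_product_on UNIV (g p)) \<and>
     (\<forall>c\<in>A. \<forall>u v. smooth_fun_on A (fst c) (\<lambda>p. g p (coord_field A c u p) (coord_field A c v p)))"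

definition riemannian_manifold ::
  "'a topology \<Rightarrow> ('a, 'n::finite) chart set \<Rightarrow> ('a \<Rightarrow> real ^ 'n \<Rightarrow> real ^ 'n \<Rightarrow> real) \<Rightarrow> bool" where
  "riemannian_manifold M A g \<longleftrightarrow> smooth_manifold M A \<and> riemannian_metric M A g"

definition tensor_field_04 ::
  "'a topology \<Rightarrow> ('a, 'n::finite) chart set \<Rightarrow>
   ('a \<Rightarrow> real ^ 'n \<Rightarrow> real ^ 'n \<Rightarrow> real ^ 'n \<Rightarrow> real ^ 'n \<Rightarrow> real) \<Rightarrow> bool" where
  "tensor_field_04 M A T \<longleftrightarrow>
     (\<forall>p\<in>topspace M. \<forall>x y z.
        linear (\<lambda>w. T p w x y z) \<and> linear (\<lambda>w. T p x w y z) \<and>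
        linear (\<lambda>w. T p x y w z) \<and> linear (\<lambda>w. T p x y z w)) \<and>
     (\<forall>c\<in>A. \<forall>u1 u2 u3 u4. smooth_fun_on A (fst c)
        (\<lambda>p. T p (coord_field A c u1 p) (coord_field A c u2 p)
                (coord_field A c u3 p) (coord_field A c u4 p)))"

definition curvature_like ::
  "'a topology \<Rightarrow> ('a, 'n::finite) chart set \<Rightarrow>
   ('a \<Rightarrow> real ^ 'n \<Rightarrow> real ^ 'n \<Rightarrow> real ^ 'n \<Rightarrow> real ^ 'n \<Rightarrow> real) \<Rightarrow> bool" where
  "curvature_like M A T \<longleftrightarrow> tensor_field_04 M A T \<and>
     (\<forall>p\<in>topspace M. \<forall>x y z w.
        T p x y z w = - T p y x z w \<and>
        T p x y z w = T p z w x y \<and>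
        T p x y z w + T p y z x w + T p z x y w = 0)"


section \<open>Riemannian vector bundles\<close>

text \<open>The fibres of a vector bundle are subspaces \<open>B p\<close> of a common vector space (not required to be
  finite-dimensional). Its smooth structure is given by a family \<open>F\<close> of local
  frames \<open>(U, s)\<close>, that is, of local trivialisations, with smooth transition functions. Frames are
  indexed by a finite set \<open>I\<close> whose cardinality is the rank; rank 0 is allowed.\<close>

type_synonym ('a, 'b) frame = "'a set \<times> (nat \<Rightarrow> 'a \<Rightarrow> 'b)"

definition smooth_section_on ::
  "('a, 'n::finite) chart set \<Rightarrow> nat set \<Rightarrow> ('a, 'b::real_vector) frame set \<Rightarrow>
   'a set \<Rightarrow> ('a \<Rightarrow> 'b) \<Rightarrow> bool" where
  "smooth_section_on A I F W \<sigma> \<longleftrightarrow>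
     (\<forall>(U, s)\<in>F. \<exists>a :: nat \<Rightarrow> 'a \<Rightarrow> real.
        (\<forall>\<alpha>\<in>I. smooth_fun_on A (W \<inter> U) (a \<alpha>)) \<and>
        (\<forall>p\<in>W \<inter> U. \<sigma> p = (\<Sum>\<alpha>\<in>I. a \<alpha> p *\<^sub>R s \<alpha> p)))"

definition vector_bundle ::
  "'a topology \<Rightarrow> ('a, 'n::finite) chart set \<Rightarrow> nat set \<Rightarrow>
   ('a \<Rightarrow> 'b::real_vector set) \<Rightarrow> ('a, 'b) frame set \<Rightarrow> bool" where
  "vector_bundle M A I B F \<longleftrightarrow>
     finite I \<and>
     (\<forall>p\<in>topspace M. subspace (B p)) \<and>
     (\<Union>(U, s)\<in>F. U) = topspace M \<and>
     (\<forall>(U, s)\<in>F. openin M U \<and>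
        (\<forall>p\<in>U. inj_on (\<lambda>\<alpha>. s \<alpha> p) I \<and> independent ((\<lambda>\<alpha>. s \<alpha> p) ` I) \<and>
               span ((\<lambda>\<alpha>. s \<alpha> p) ` I) = B p) \<and>
        (\<forall>\<alpha>\<in>I. smooth_section_on A I F U (s \<alpha>)))"

definition riemannian_vector_bundle ::
  "'a topology \<Rightarrow> ('a, 'n::finite) chart set \<Rightarrow> nat set \<Rightarrow>
   ('a \<Rightarrow> 'b::real_vector set) \<Rightarrow> ('a, 'b) frame set \<Rightarrow> ('a \<Rightarrow> 'b \<Rightarrow> 'b \<Rightarrow> real) \<Rightarrow> bool" where
  "riemannian_vector_bundle M A I B F gB \<longleftrightarrow>
     vector_bundle M A I B F \<and>
     (\<forall>p\<in>topspace M. inner_product_on (B p) (gB p)) \<and>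
     (\<forall>(U, s)\<in>F. \<forall>\<alpha>\<in>I. \<forall>\<beta>\<in>I. smooth_fun_on A U (\<lambda>p. gB p (s \<alpha> p) (s \<beta> p)))"

definition symmetric_12_tensor_field ::
  "'a topology \<Rightarrow> ('a, 'n::finite) chart set \<Rightarrow> nat set \<Rightarrow>
   ('a \<Rightarrow> 'b::real_vector set) \<Rightarrow> ('a, 'b) frame set \<Rightarrow>
   ('a \<Rightarrow> real ^ 'n \<Rightarrow> real ^ 'n \<Rightarrow> 'b) \<Rightarrow> bool" where
  "symmetric_12_tensor_field M A I B F \<zeta> \<longleftrightarrow>
     (\<forall>p\<in>topspace M. bilinear (\<zeta> p) \<and> (\<forall>x y. \<zeta> p x y = \<zeta> p y x \<and> \<zeta> p x y \<in> B p)) \<and>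
     (\<forall>c\<in>A. \<forall>u v. smooth_section_on A I F (fst c)
        (\<lambda>p. \<zeta> p (coord_field A c u p) (coord_field A c v p)))"

definition algebraic_gauss_equation ::
  "'a topology \<Rightarrow> ('a, 'n::finite) chart set \<Rightarrow> ('a \<Rightarrow> 'b \<Rightarrow> 'b \<Rightarrow> real) \<Rightarrow>
   ('a \<Rightarrow> real ^ 'n \<Rightarrow> real ^ 'n \<Rightarrow> 'b) \<Rightarrow>
   ('a \<Rightarrow> real ^ 'n \<Rightarrow> real ^ 'n \<Rightarrow> real ^ 'n \<Rightarrow> real ^ 'n \<Rightarrow> real) \<Rightarrow> bool" where
  "algebraic_gauss_equation M A gB \<zeta> T \<longleftrightarrow>
     (\<forall>X Y Z W. vector_field A X \<and> vector_field A Y \<and> vector_field A Z \<and> vector_field A W \<longrightarrow>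
        (\<forall>p\<in>topspace M.
           T p (X p) (Y p) (Z p) (W p) =
             gB p (\<zeta> p (X p) (W p)) (\<zeta> p (Y p) (Z p)) - gB p (\<zeta> p (X p) (Z p)) (\<zeta> p (Y p) (W p))))"


section \<open>Scalar and Casorati curvatures\<close>

definition orthonormal_basis ::
  "('v::real_vector \<Rightarrow> 'v \<Rightarrow> real) \<Rightarrow> 'v set \<Rightarrow> nat set \<Rightarrow> (nat \<Rightarrow> 'v) \<Rightarrow> bool" where
  "orthonormal_basis h V I e \<longleftrightarrow>
     (\<forall>i\<in>I. e i \<in> V) \<and> (\<forall>i\<in>I. \<forall>j\<in>I. h (e i) (e j) = (if i = j then 1 else 0)) \<and> span (e ` I) = V"

text \<open>The scalar and Casorati curvatures do not depend on the orthonormal bases picked by \<open>SOME\<close>.\<close>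

definition scalar_curvature ::
  "('a \<Rightarrow> real ^ 'n::finite \<Rightarrow> real ^ 'n \<Rightarrow> real) \<Rightarrow>
   ('a \<Rightarrow> real ^ 'n \<Rightarrow> real ^ 'n \<Rightarrow> real ^ 'n \<Rightarrow> real ^ 'n \<Rightarrow> real) \<Rightarrow> 'a \<Rightarrow> real" where
  "scalar_curvature g T p =
     (let e = (SOME e. orthonormal_basis (g p) UNIV {1..CARD('n)} e)
      in \<Sum>j=1..CARD('n). \<Sum>i=1..<j. T p (e i) (e j) (e j) (e i))"

definition normalized_scalar_curvature ::
  "('a \<Rightarrow> real ^ 'n::finite \<Rightarrow> real ^ 'n \<Rightarrow> real) \<Rightarrow>
   ('a \<Rightarrow> real ^ 'n \<Rightarrow> real ^ 'n \<Rightarrow> real ^ 'n \<Rightarrow> real ^ 'n \<Rightarrow> real) \<Rightarrow> 'a \<Rightarrow> real" where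
  "normalized_scalar_curvature g T p =
     2 / (real CARD('n) * (real CARD('n) - 1)) * scalar_curvature g T p"

text \<open>\<open>I\<close> is the index set of orthonormal bases of the fibre \<open>B p\<close>.\<close>

definition casorati ::
  "('a \<Rightarrow> real ^ 'n::finite \<Rightarrow> real ^ 'n \<Rightarrow> real) \<Rightarrow> nat set \<Rightarrow> ('a \<Rightarrow> 'b::real_vector set) \<Rightarrow>
   ('a \<Rightarrow> 'b \<Rightarrow> 'b \<Rightarrow> real) \<Rightarrow> ('a \<Rightarrow> real ^ 'n \<Rightarrow> real ^ 'n \<Rightarrow> 'b) \<Rightarrow>
   'a \<Rightarrow> (real ^ 'n) set \<Rightarrow> real" where
  "casorati g I B gB \<zeta> p P =
     (let k = dim P;
          e = (SOME e. orthonormal_basis (g p) P {1..k} e);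
          f = (SOME f. orthonormal_basis (gB p) (B p) I f)
      in 1 / real k * (\<Sum>\<alpha>\<in>I. \<Sum>i=1..k. \<Sum>j=1..k. (gB p (\<zeta> p (e i) (e j)) (f \<alpha>))\<^sup>2))"

definition hyperplanes :: "(real ^ 'n::finite) set set" where
  "hyperplanes = {P. subspace P \<and> dim P = CARD('n) - 1}"

definition casorati_delta ::
  "('a \<Rightarrow> real ^ 'n::finite \<Rightarrow> real ^ 'n \<Rightarrow> real) \<Rightarrow> nat set \<Rightarrow> ('a \<Rightarrow> 'b::real_vector set) \<Rightarrow>
   ('a \<Rightarrow> 'b \<Rightarrow> 'b \<Rightarrow> real) \<Rightarrow> ('a \<Rightarrow> real ^ 'n \<Rightarrow> real ^ 'n \<Rightarrow> 'b) \<Rightarrow> 'a \<Rightarrow> real" where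
  "casorati_delta g I B gB \<zeta> p =
     1 / 2 * casorati g I B gB \<zeta> p UNIV +
     (real CARD('n) + 1) / (2 * real CARD('n)) * Inf (casorati g I B gB \<zeta> p ` hyperplanes)"

end

theory Submission
  imports Defs
begin

text \<open>The algebraic Gauss equation is assumed for smooth vector fields only; multiplying a coordinate
  field by a bump function gives a vector field with any prescribed value at \<open>p\<close>, so the equation
  holds for arbitrary tangent vectors at \<open>p\<close>. Everything else is linear algebra in one tangent space.
  For a hyperplane \<open>P\<close> choose an orthonormal basis whose first \<open>n - 1\<close> vectors span \<open>P\<close>. For each
  normal direction with matrix \<open>b\<close>, the claim with \<open>P\<close> in place of the infimum reduces to
  \<open>(\<Sum>i\<le>n. b i i)\<^sup>2 \<le> (n + 1) / 2 * ((\<Sum>i,j\<le>n. (b i j)\<^sup>2) + (\<Sum>i,j<n. (b i j)\<^sup>2))\<close>,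
  which is a weighted Cauchy-Schwarz inequality, with equality iff \<open>b\<close> is diagonal with
  \<open>2 b i i = b n n\<close> for \<open>i < n\<close>. Conversely, such a basis forces equality for the hyperplane spanned by
  its first \<open>n - 1\<close> vectors, and hence for the infimum.\<close>

section \<open>Calculus of continuously differentiable functions\<close>

text \<open>On an open \<open>S\<close> the two functions agree near each point, so their
  derivatives agree as well. The closure rules below use this to trade
  \<open>frechet_derivative\<close> of a compound function for the explicit formula.\<close>

lemma Ck_on_cong:
  assumes "open S" "\<And>x. x \<in> S \<Longrightarrow> f x = g x" "Ck_on k S f"
  shows "Ck_on k S g"
  using assms(2,3)
proof (induction k arbitrary: f g)
  case 0
  then show ?case using continuous_on_cong[of S S f g] by simp
next
  case (Suc k)
  have d: "f differentiable (at x)" if "x \<in> S" for x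
    using Suc.prems(2) that by simp
  have dg: "(g has_derivative frechet_derivative f (at x)) (at x)" if "x \<in> S" for x
    by (rule has_derivative_transform_within_open[OF _ assms(1) that Suc.prems(1)])
      (use d[OF that] frechet_derivative_works in blast)
  have eq: "frechet_derivative f (at x) = frechet_derivative g (at x)" if "x \<in> S" for x
    using frechet_derivative_at[OF dg[OF that]] .
  have "Ck_on k S (\<lambda>x. frechet_derivative g (at x) v)" for v
    by (rule Suc.IH[of "\<lambda>x. frechet_derivative f (at x) v"]) (use eq Suc.prems(2) in auto)
  then show ?case
    using dg by (auto simp: differentiable_def)
qed

lemma Ck_on_subset: "Ck_on k S f \<Longrightarrow> T \<subseteq> S \<Longrightarrow> Ck_on k T f"
proof (induction k arbitrary: f)
  case 0
  then show ?case by (simp add: continuous_on_subset[of S f T])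
next
  case (Suc k)
  have "Ck_on k T (\<lambda>x. frechet_derivative f (at x) v)" for v
    by (rule Suc.IH) (use Suc.prems in auto)
  then show ?case using Suc.prems by auto
qed

text \<open>Derivatives are taken in full neighbourhoods (\<open>at x\<close>), so only the
  behaviour near each point counts. This lets a vector field be checked separately where the bump
  lives and where it vanishes.\<close>

lemma Ck_on_local:
  assumes "\<And>x. x \<in> S \<Longrightarrow> \<exists>U. open U \<and> x \<in> U \<and> Ck_on k U f"
  shows "Ck_on k S f"
  using assms
proof (induction k arbitrary: f)
  case 0
  have "isCont f x" if x: "x \<in> S" for x
  proof -
    obtain U where "open U" "x \<in> U" "continuous_on U f"
      using 0[OF x] unfolding Ck_on.simps by blast
    then show ?thesis
      by (simp add: continuous_on_eq_continuous_at)
  qed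
  then show ?case by (simp add: continuous_at_imp_continuous_on)
next
  case (Suc k)
  have "f differentiable (at x)" if "x \<in> S" for x
    using Suc.prems[OF that] by (auto simp del: Ck_on.simps(1))
  moreover have "Ck_on k S (\<lambda>x. frechet_derivative f (at x) v)" for v
  proof (rule Suc.IH)
    fix x assume "x \<in> S"
    then obtain U where "open U" "x \<in> U" "Ck_on (Suc k) U f"
      using Suc.prems by blast
    then show "\<exists>U. open U \<and> x \<in> U \<and> Ck_on k U (\<lambda>x. frechet_derivative f (at x) v)"
      by (intro exI[of _ U]) simp
  qed
  ultimately show ?case by simp
qed

text \<open>The recursion never mentions continuity of the lower derivatives; it is recovered from
  differentiability at the bottom of the induction.\<close>

lemma Ck_on_Suc_imp: "Ck_on (Suc k) S f \<Longrightarrow> Ck_on k S f"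
proof (induction k arbitrary: f)
  case 0
  then show ?case
    by (simp add: differentiable_imp_continuous_on differentiable_on_def differentiable_at_withinI)
next
  case (Suc k)
  have "Ck_on k S (\<lambda>x. frechet_derivative f (at x) v)" for v
    using Suc.prems by (intro Suc.IH) (subst (asm) Ck_on.simps(2), blast)
  moreover have "\<forall>x\<in>S. f differentiable (at x)"
    using Suc.prems by (subst (asm) Ck_on.simps(2), blast)
  ultimately show ?case
    by (subst Ck_on.simps(2)) blast
qed

lemma Ck_on_const: "Ck_on k S (\<lambda>x. a)"
  by (induction k arbitrary: a) auto

lemma Ck_on_bounded_linear_comp:
  assumes "open S" "bounded_linear L" "Ck_on k S f"
  shows "Ck_on k S (\<lambda>x. L (f x))"
  using assms(3)
proof (induction k arbitrary: f)
  case 0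
  then show ?case
    using bounded_linear.continuous_on[OF assms(2)] by auto
next
  case (Suc k)
  have d: "((\<lambda>x. L (f x)) has_derivative (\<lambda>v. L (frechet_derivative f (at x) v))) (at x)"
    if "x \<in> S" for x
    using Suc.prems that bounded_linear.has_derivative[OF assms(2)] frechet_derivative_works
    by (metis Ck_on.simps(2))
  have "Ck_on k S (\<lambda>x. L (frechet_derivative f (at x) v))" for v
    using Suc by simp
  then have "Ck_on k S (\<lambda>x. frechet_derivative (\<lambda>x. L (f x)) (at x) v)" for v
    by (rule Ck_on_cong[OF assms(1), rotated]) (simp add: frechet_derivative_at[OF d, symmetric])
  then show ?case using d by (auto simp: differentiable_def)
qed

lemma Ck_on_add:
  assumes "open S" "Ck_on k S f" "Ck_on k S g"
  shows "Ck_on k S (\<lambda>x. f x + g x)"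
  using assms(2,3)
proof (induction k arbitrary: f g)
  case 0
  then show ?case by (simp add: continuous_on_add)
next
  case (Suc k)
  have d: "((\<lambda>x. f x + g x) has_derivative
      (\<lambda>v. frechet_derivative f (at x) v + frechet_derivative g (at x) v)) (at x)"
    if "x \<in> S" for x
    using Suc.prems that by (intro has_derivative_add) (auto simp: frechet_derivative_works)
  have "Ck_on k S (\<lambda>x. frechet_derivative f (at x) v + frechet_derivative g (at x) v)" for v
    using Suc by simp
  then have "Ck_on k S (\<lambda>x. frechet_derivative (\<lambda>x. f x + g x) (at x) v)" for v
    by (rule Ck_on_cong[OF assms(1), rotated]) (simp add: frechet_derivative_at[OF d, symmetric])
  then show ?case using d by (auto simp: differentiable_def)
qed

lemma Ck_on_sum:
  assumes "open S" "\<And>i. i \<in> I \<Longrightarrow> Ck_on k S (f i)"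
  shows "Ck_on k S (\<lambda>x. \<Sum>i\<in>I. f i x)"
  using assms(2)
  by (induction I rule: infinite_finite_induct) (auto intro: Ck_on_const Ck_on_add assms(1))

text \<open>Product rule. Both factors are generalised in the induction, since each summand pairs
  one undifferentiated factor, lowered by one order, with a derivative of the other.\<close>

lemma Ck_on_scaleR:
  fixes f :: "'e::euclidean_space \<Rightarrow> real"
  assumes "open S" "Ck_on k S f" "Ck_on k S g"
  shows "Ck_on k S (\<lambda>x. f x *\<^sub>R g x)"
  using assms(2,3)
proof (induction k arbitrary: f g)
  case 0
  then show ?case by (simp add: continuous_on_scaleR)
next
  case (Suc k)
  have d: "((\<lambda>x. f x *\<^sub>R g x) has_derivative
      (\<lambda>v. f x *\<^sub>R frechet_derivative g (at x) v + frechet_derivative f (at x) v *\<^sub>R g x)) (at x)"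
    if "x \<in> S" for x
    using Suc.prems that by (intro has_derivative_scaleR) (auto simp: frechet_derivative_works)
  have "Ck_on k S (\<lambda>x. f x *\<^sub>R frechet_derivative g (at x) v + frechet_derivative f (at x) v *\<^sub>R g x)"
    for v
    using Suc.prems Ck_on_Suc_imp[OF Suc.prems(1)] Ck_on_Suc_imp[OF Suc.prems(2)]
    by (intro Ck_on_add Suc.IH assms(1)) auto
  then have "Ck_on k S (\<lambda>x. frechet_derivative (\<lambda>x. f x *\<^sub>R g x) (at x) v)" for v
    by (rule Ck_on_cong[OF assms(1), rotated]) (simp add: frechet_derivative_at[OF d, symmetric])
  then show ?case using d by (auto simp: differentiable_def)
qed

text \<open>\<open>Ck_on\<close> controls derivatives in fixed directions, while the chain rule
  differentiates \<open>f\<close> in a direction that moves with \<open>x\<close>. Expanding that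
  direction in \<open>Basis\<close> leaves products of scalar functions with derivatives of
  \<open>f\<close> in fixed directions, composed with \<open>g\<close>.\<close>

lemma Ck_on_compose:
  fixes g :: "'e::euclidean_space \<Rightarrow> 'f::euclidean_space"
  assumes "open S" "open T" "g ` S \<subseteq> T" "Ck_on k T f" "Ck_on k S g"
  shows "Ck_on k S (\<lambda>x. f (g x))"
  using assms(4,5)
proof (induction k arbitrary: f)
  case 0
  then show ?case using continuous_on_compose2 assms(3) by fastforce
next
  case (Suc k)
  have dg: "(g has_derivative frechet_derivative g (at x)) (at x)" if "x \<in> S" for x
    using Suc.prems(2) that frechet_derivative_works by auto
  have df: "(f has_derivative frechet_derivative f (at (g x))) (at (g x))" if "x \<in> S" for x
    using Suc.prems(1) that assms(3) frechet_derivative_works by auto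
  have d: "((\<lambda>x. f (g x)) has_derivative
      (\<lambda>v. frechet_derivative f (at (g x)) (frechet_derivative g (at x) v))) (at x)"
    if "x \<in> S" for x
    using has_derivative_compose[OF dg df] that by blast
  have expand: "(\<Sum>b\<in>Basis. (frechet_derivative g (at x) v \<bullet> b) *\<^sub>R frechet_derivative f (at (g x)) b) =
      frechet_derivative f (at (g x)) (frechet_derivative g (at x) v)" if "x \<in> S" for x v
  proof -
    have l: "linear (frechet_derivative f (at (g x)))"
      using df[OF that] has_derivative_linear by blast
    show ?thesis
      by (subst (2) euclidean_representation[symmetric])
        (simp add: linear_sum[OF l] linear_scale[OF l])
  qed
  have "Ck_on k S (\<lambda>x. \<Sum>b\<in>Basis. (frechet_derivative g (at x) v \<bullet> b) *\<^sub>R frechet_derivative f (at (g x)) b)"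
    for v
  proof (rule Ck_on_sum[OF assms(1)], rule Ck_on_scaleR[OF assms(1)])
    fix b :: 'f
    show "Ck_on k S (\<lambda>x. frechet_derivative g (at x) v \<bullet> b)"
      by (rule Ck_on_bounded_linear_comp[OF assms(1) bounded_linear_inner_left]) (use Suc.prems(2) in auto)
    show "Ck_on k S (\<lambda>x. frechet_derivative f (at (g x)) b)"
      by (rule Suc.IH) (use Suc.prems(1) Ck_on_Suc_imp[OF Suc.prems(2)] in auto)
  qed
  then have "Ck_on k S (\<lambda>x. frechet_derivative (\<lambda>x. f (g x)) (at x) v)" for v
    by (rule Ck_on_cong[OF assms(1), rotated])
      (simp add: expand frechet_derivative_at[OF d, symmetric])
  then show ?case using d by (auto simp: differentiable_def)
qed

lemma Ck_on_bounded_linear: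
  assumes "bounded_linear L"
  shows "Ck_on k S L"
proof (cases k)
  case 0
  then show ?thesis using assms linear_continuous_on by auto
next
  case (Suc j)
  have d: "(L has_derivative L) (at x)" for x
    using bounded_linear_imp_has_derivative[OF assms] .
  show ?thesis
    using d by (auto simp: Suc differentiable_def frechet_derivative_at[OF d, symmetric] Ck_on_const)
qed

section \<open>Transfer of the closure rules from finite order to smooth functions\<close>

lemma smooth_on_cong:
  "open S \<Longrightarrow> (\<And>x. x \<in> S \<Longrightarrow> f x = g x) \<Longrightarrow> smooth_on S f \<Longrightarrow> smooth_on S g"
  unfolding smooth_on_def using Ck_on_cong by blast

lemma smooth_on_subset: "smooth_on S f \<Longrightarrow> T \<subseteq> S \<Longrightarrow> smooth_on T f"
  unfolding smooth_on_def using Ck_on_subset by blast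

lemma smooth_on_local:
  assumes "\<And>x. x \<in> S \<Longrightarrow> \<exists>U. open U \<and> x \<in> U \<and> smooth_on U f"
  shows "smooth_on S f"
  unfolding smooth_on_def
proof
  fix k
  show "Ck_on k S f"
    by (rule Ck_on_local) (use assms in \<open>unfold smooth_on_def, blast\<close>)
qed

lemma smooth_on_const: "smooth_on S (\<lambda>x. a)"
  by (simp add: smooth_on_def Ck_on_const)

lemma smooth_on_bounded_linear: "bounded_linear L \<Longrightarrow> smooth_on S L"
  by (simp add: smooth_on_def Ck_on_bounded_linear)

lemma smooth_on_add:
  "open S \<Longrightarrow> smooth_on S f \<Longrightarrow> smooth_on S g \<Longrightarrow> smooth_on S (\<lambda>x. f x + g x)"
  by (simp add: smooth_on_def Ck_on_add)

lemma smooth_on_sum: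
  "open S \<Longrightarrow> (\<And>i. i \<in> I \<Longrightarrow> smooth_on S (f i)) \<Longrightarrow> smooth_on S (\<lambda>x. \<Sum>i\<in>I. f i x)"
  by (simp add: smooth_on_def Ck_on_sum)

lemma smooth_on_scaleR:
  fixes f :: "'e::euclidean_space \<Rightarrow> real"
  shows "open S \<Longrightarrow> smooth_on S f \<Longrightarrow> smooth_on S g \<Longrightarrow> smooth_on S (\<lambda>x. f x *\<^sub>R g x)"
  by (simp add: smooth_on_def Ck_on_scaleR)

lemma smooth_on_compose:
  fixes g :: "'e::euclidean_space \<Rightarrow> 'f::euclidean_space"
  shows "open S \<Longrightarrow> open T \<Longrightarrow> g ` S \<subseteq> T \<Longrightarrow> smooth_on T f \<Longrightarrow> smooth_on S g \<Longrightarrow>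
    smooth_on S (\<lambda>x. f (g x))"
  unfolding smooth_on_def by (intro allI, erule (2) Ck_on_compose) simp_all

lemma smooth_on_deriv: "smooth_on S f \<Longrightarrow> smooth_on S (\<lambda>x. frechet_derivative f (at x) v)"
  unfolding smooth_on_def by (metis Ck_on.simps(2))

lemma smooth_on_differentiable: "smooth_on S f \<Longrightarrow> x \<in> S \<Longrightarrow> f differentiable (at x)"
  unfolding smooth_on_def by (metis Ck_on.simps(2))


section \<open>Bump functions\<close>

text \<open>The derivative of \<open>flat_exp P\<close> is \<open>flat_exp Q\<close> for another polynomial \<open>Q\<close>, so all these
  functions are smooth at once.\<close>

definition flat_exp :: "real poly \<Rightarrow> real \<Rightarrow> real" where
  "flat_exp P t = (if t > 0 then poly P (1 / t) * exp (- (1 / t)) else 0)"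

text \<open>Under s = 1/t this is the decay that makes every \<open>flat_exp P\<close> vanish to
  infinite order at 0 from the right.\<close>

lemma poly_exp_minus_tendsto_0: "((\<lambda>s::real. poly P s * exp (- s)) \<longlongrightarrow> 0) at_top"
proof -
  have "((\<lambda>s::real. \<Sum>i\<le>degree P. coeff P i * (s ^ i * exp (- s))) \<longlongrightarrow>
      (\<Sum>i\<le>degree P. coeff P i * 0)) at_top"
    unfolding exp_minus divide_inverse[symmetric]
    by (intro tendsto_sum tendsto_mult tendsto_const tendsto_power_div_exp_0)
  then show ?thesis
    by (simp add: poly_altdef sum_distrib_right mult.assoc)
qed

text \<open>With s = 1/t one has ds/dt = -s^2, so P(s) exp(-s) has derivative s^2 (P(s) - P'(s))
  exp(-s); the factor s^2 is \<open>[:0, 0, 1:]\<close>. At t = 0 both one-sided difference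
  quotients tend to 0.\<close>

lemma has_field_derivative_flat_exp:
  "(flat_exp P has_field_derivative flat_exp ([:0, 0, 1:] * (P - pderiv P)) t) (at t)"
proof -
  consider "t > 0" | "t < 0" | "t = 0" by linarith
  then show ?thesis
  proof cases
    case 1
    have "((\<lambda>t. poly P (1 / t) * exp (- (1 / t))) has_field_derivative
        flat_exp ([:0, 0, 1:] * (P - pderiv P)) t) (at t)"
      using 1
      by (auto intro!: derivative_eq_intros simp: flat_exp_def field_simps power2_eq_square)
    then show ?thesis
      by (rule has_field_derivative_transform_within_open[of _ _ _ "{0<..}"])
        (use 1 in \<open>auto simp: flat_exp_def\<close>)
  next
    case 2
    have "((\<lambda>t. 0) has_field_derivative flat_exp ([:0, 0, 1:] * (P - pderiv P)) t) (at t)"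
      using 2 by (auto simp: flat_exp_def)
    then show ?thesis
      by (rule has_field_derivative_transform_within_open[of _ _ _ "{..<0}"])
        (use 2 in \<open>auto simp: flat_exp_def\<close>)
  next
    case 3
    \<comment> \<open>Dividing by h multiplies by 1/h, which amounts to replacing P by X * P; the
      decay at infinity covers that polynomial too.\<close>
    have "((\<lambda>h. poly ([:0, 1:] * P) (inverse h) * exp (- inverse h)) \<longlongrightarrow> 0) (at_right 0)"
      using filterlim_compose[OF poly_exp_minus_tendsto_0 filterlim_inverse_at_top_right] .
    then have "((\<lambda>h. flat_exp P h / h) \<longlongrightarrow> 0) (at_right 0)"
      by (rule Lim_transform_eventually)
        (auto simp: flat_exp_def field_simps eventually_at_right_field intro!: exI[of _ 1])
    moreover have "((\<lambda>h. flat_exp P h / h) \<longlongrightarrow> 0) (at_left 0)"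
      by (rule Lim_transform_eventually[OF tendsto_const])
        (auto simp: flat_exp_def eventually_at_left_field intro!: exI[of _ "-1"])
    ultimately have "((\<lambda>h. flat_exp P h / h) \<longlongrightarrow> 0) (at 0)"
      by (simp add: filterlim_split_at)
    then show ?thesis
      using 3 by (simp add: DERIV_def flat_exp_def)
  qed
qed

lemma smooth_on_flat_exp: "smooth_on S (flat_exp P)"
proof -
  have "Ck_on k UNIV (flat_exp P)" for k
  proof (induction k arbitrary: P)
    case 0
    show ?case
      using DERIV_isCont[OF has_field_derivative_flat_exp]
      by (simp add: continuous_at_imp_continuous_on)
  next
    case (Suc k)
    let ?Q = "[:0, 0, 1:] * (P - pderiv P)"
    have d: "(flat_exp P has_derivative (*) (flat_exp ?Q x)) (at x)" for x
      using has_field_derivative_flat_exp unfolding has_field_derivative_def .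
    have "Ck_on k UNIV (\<lambda>x. flat_exp ?Q x * v)" for v
      using Ck_on_bounded_linear_comp[OF _ bounded_linear_mult_left Suc.IH] by simp
    then show ?case
      using d by (auto simp: differentiable_def frechet_derivative_at[OF d, symmetric]
        simp del: mult_pCons_left)
  qed
  then show ?thesis
    unfolding smooth_on_def by (metis Ck_on_subset subset_UNIV)
qed

text \<open>The function is exp(-1 / (r^2 - |x - x0|^2)) inside the ball and 0 outside, scaled to be
  1 at the centre. Using the squared distance avoids the singularity of the norm at
  \<open>x0\<close>; it is spelled out by sums and scalings to match the closure rules.\<close>

lemma bump_function:
  fixes x0 :: "'e::euclidean_space"
  assumes "r > 0"
  obtains \<phi> :: "'e \<Rightarrow> real" where "\<And>S. open S \<Longrightarrow> smooth_on S \<phi>" "\<phi> x0 = 1"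
    "\<And>x. x \<notin> cball x0 r \<Longrightarrow> \<phi> x = 0"
proof
  let ?q = "\<lambda>x. (r\<^sup>2 + (- 1) *\<^sub>R (\<Sum>b\<in>Basis. ((x + - x0) \<bullet> b) *\<^sub>R ((x + - x0) \<bullet> b)))"
  let ?\<phi> = "\<lambda>x. (1 / flat_exp 1 (r\<^sup>2)) *\<^sub>R flat_exp 1 (?q x)"
  have q: "?q x = r\<^sup>2 - (dist x0 x)\<^sup>2" for x
    by (subst dist_commute) (simp add: dist_norm power2_norm_eq_inner
        euclidean_inner[of "x - x0" "x - x0", symmetric])
  show "smooth_on S ?\<phi>" if "open S" for S
  proof -
    have "smooth_on S (\<lambda>x. x + - x0)"
      by (intro smooth_on_add smooth_on_const smooth_on_bounded_linear bounded_linear_ident that)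
    then have l: "smooth_on S (\<lambda>x. (x + - x0) \<bullet> b)" for b
      using smooth_on_compose[OF that open_UNIV _
          smooth_on_bounded_linear[OF bounded_linear_inner_left], of "\<lambda>x. x + - x0" b]
      by simp
    have "smooth_on S ?q"
      by (rule smooth_on_add[OF that smooth_on_const], rule smooth_on_scaleR[OF that smooth_on_const],
          rule smooth_on_sum[OF that], rule smooth_on_scaleR[OF that l l])
    then have "smooth_on S (\<lambda>x. flat_exp 1 (?q x))"
      by (rule smooth_on_compose[OF that open_UNIV subset_UNIV smooth_on_flat_exp])
    then show ?thesis
      by (rule smooth_on_scaleR[OF that smooth_on_const])
  qed
  show "?\<phi> x0 = 1"
    using assms by (simp add: flat_exp_def)
  show "?\<phi> x = 0" if "x \<notin> cball x0 r" for x
  proof -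
    have "r\<^sup>2 < (dist x0 x)\<^sup>2"
      using that assms by (intro power_strict_mono) auto
    then show ?thesis unfolding q by (simp add: flat_exp_def)
  qed
qed


section \<open>Vector fields with a prescribed value at a point\<close>

lemma chart_at:
  assumes "smooth_manifold M A" "p \<in> topspace M"
  shows "chart_at A p \<in> A" "p \<in> fst (chart_at A p)"
proof -
  have "\<exists>c. c \<in> A \<and> p \<in> fst c"
    using assms unfolding smooth_manifold_def by blast
  then have "chart_at A p \<in> A \<and> p \<in> fst (chart_at A p)"
    unfolding chart_at_def by (rule someI_ex)
  then show "chart_at A p \<in> A" "p \<in> fst (chart_at A p)" by auto
qed

section \<open>Charts, transition maps and change of components\<close>

lemma is_chart_inj_on:
  assumes "is_chart M c"
  shows "inj_on (snd c) (fst c)"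
proof -
  have "topspace (subtopology M (fst c)) = fst c"
    using assms openin_subset by (auto simp: is_chart_def)
  then show ?thesis
    using assms homeomorphic_imp_injective_map unfolding is_chart_def by metis
qed

lemma is_chart_open_image:
  assumes "is_chart M c" "openin M V" "V \<subseteq> fst c"
  shows "open (snd c ` V)"
proof -
  have c: "openin M (fst c)" "open (snd c ` fst c)"
      "homeomorphic_map (subtopology M (fst c)) (top_of_set (snd c ` fst c)) (snd c)"
    using assms(1) by (auto simp: is_chart_def)
  have "openin (subtopology M (fst c)) V"
    using c(1) assms(2,3) by (simp add: openin_open_subtopology)
  then have "openin (top_of_set (snd c ` fst c)) (snd c ` V)"
    using homeomorphic_imp_open_map[OF c(3)] unfolding open_map_def by blast
  then show ?thesis
    using c(2) openin_open_trans by blast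
qed

lemma chart_inv_snd: "is_chart M c \<Longrightarrow> p \<in> fst c \<Longrightarrow> chart_inv c (snd c p) = p"
  unfolding chart_inv_def by (simp add: is_chart_inj_on)

lemma transition_snd: "is_chart M c \<Longrightarrow> p \<in> fst c \<Longrightarrow> transition c d (snd c p) = snd d p"
  unfolding transition_def by (simp add: chart_inv_snd)

lemma smooth_manifold_chart: "smooth_manifold M A \<Longrightarrow> c \<in> A \<Longrightarrow> is_chart M c"
  by (simp add: smooth_manifold_def)

lemma smooth_manifold_openin: "smooth_manifold M A \<Longrightarrow> c \<in> A \<Longrightarrow> openin M (fst c)"
  by (simp add: smooth_manifold_def is_chart_def)

lemma smooth_on_transition:
  "smooth_manifold M A \<Longrightarrow> c \<in> A \<Longrightarrow> d \<in> A \<Longrightarrow>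
    smooth_on (snd c ` (fst c \<inter> fst d)) (transition c d)"
  by (simp add: smooth_manifold_def)

lemma transition_has_derivative:
  assumes "smooth_manifold M A" "c \<in> A" "d \<in> A" "p \<in> fst c" "p \<in> fst d"
  shows "(transition c d has_derivative frechet_derivative (transition c d) (at (snd c p))) (at (snd c p))"
proof -
  have "transition c d differentiable (at (snd c p))"
    by (rule smooth_on_differentiable[OF smooth_on_transition[OF assms(1-3)]]) (use assms(4,5) in auto)
  then show ?thesis by (simp add: frechet_derivative_works)
qed

text \<open>By the chain rule the reference chart \<open>chart_at A p\<close> cancels. What remains
  involves only the fixed charts \<open>c\<close> and \<open>d\<close>, hence depends smoothly on
  \<open>p\<close> although the reference chart may jump.\<close>

lemma components_coord_field:
  assumes M: "smooth_manifold M A" and c: "c \<in> A" "p \<in> fst c" and d: "d \<in> A" "p \<in> fst d"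
  shows "components A d p (coord_field A c u p) = frechet_derivative (transition c d) (at (snd c p)) u"
proof -
  define r where "r = chart_at A p"
  have p: "p \<in> topspace M"
    using smooth_manifold_openin[OF M c(1)] c(2) openin_subset by blast
  have r: "r \<in> A" "p \<in> fst r"
    using chart_at[OF M p] by (auto simp: r_def)
  let ?V = "fst c \<inter> fst r \<inter> fst d"
  have "openin M ?V"
    using smooth_manifold_openin[OF M] c d r by blast
  then have o: "open (snd c ` ?V)"
    by (rule is_chart_open_image[OF smooth_manifold_chart[OF M c(1)]]) auto
  have "(transition r d has_derivative frechet_derivative (transition r d) (at (snd r p)))
      (at (transition c r (snd c p)))"
    using transition_has_derivative[OF M r(1) d(1) r(2) d(2)]
    by (simp add: transition_snd[OF smooth_manifold_chart[OF M c(1)] c(2)])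
  from has_derivative_compose[OF transition_has_derivative[OF M c(1) r(1) c(2) r(2)] this]
  have "(transition c d has_derivative (\<lambda>u. frechet_derivative (transition r d) (at (snd r p))
      (frechet_derivative (transition c r) (at (snd c p)) u))) (at (snd c p))"
    by (rule has_derivative_transform_within_open[OF _ o])
      (use c d r in \<open>auto simp: transition_snd[OF smooth_manifold_chart[OF M c(1)]]
        transition_snd[OF smooth_manifold_chart[OF M r(1)]]\<close>)
  from frechet_derivative_at[OF this] show ?thesis
    by (simp add: components_def coord_field_def r_def fun_eq_iff)
qed

text \<open>The transition from a chart to itself is the identity near the point. Hence a coordinate
  field of the reference chart at \<open>p\<close> can take any prescribed raw value there.\<close>

lemma coord_field_chart_at:
  assumes M: "smooth_manifold M A" and p: "p \<in> topspace M"
  shows "coord_field A (chart_at A p) u p = u"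
proof -
  define c where "c = chart_at A p"
  have c: "c \<in> A" "p \<in> fst c"
    using chart_at[OF M p] by (auto simp: c_def)
  have o: "open (snd c ` fst c)"
    using is_chart_open_image[OF smooth_manifold_chart[OF M c(1)] smooth_manifold_openin[OF M c(1)]]
    by simp
  have "(transition c c has_derivative (\<lambda>x. x)) (at (snd c p))"
    by (rule has_derivative_transform_within_open[OF has_derivative_ident o])
      (use c in \<open>auto simp: transition_snd[OF smooth_manifold_chart[OF M c(1)]]\<close>)
  from frechet_derivative_at[OF this] show ?thesis
    by (simp add: coord_field_def c_def fun_eq_iff)
qed

lemma components_zero:
  assumes M: "smooth_manifold M A" and d: "d \<in> A" "p \<in> fst d"
  shows "components A d p 0 = 0"
proof -
  have p: "p \<in> topspace M"
    using smooth_manifold_openin[OF M d(1)] d(2) openin_subset by blast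
  show ?thesis
    unfolding components_def
    using transition_has_derivative[OF M _ d(1) _ d(2)] chart_at[OF M p]
      has_derivative_linear linear_0 by blast
qed

lemma components_scaleR:
  assumes M: "smooth_manifold M A" and d: "d \<in> A" "p \<in> fst d"
  shows "components A d p (a *\<^sub>R v) = a *\<^sub>R components A d p v"
proof -
  have p: "p \<in> topspace M"
    using smooth_manifold_openin[OF M d(1)] d(2) openin_subset by blast
  show ?thesis
    unfolding components_def
    using transition_has_derivative[OF M _ d(1) _ d(2)] chart_at[OF M p]
      has_derivative_linear linear_scale by blast
qed

text \<open>Cut off a coordinate field of the reference chart at \<open>p0\<close> by a bump
  function in that chart and extend by zero. The Hausdorff property enters here: the compact support
  region is closed in \<open>M\<close>, so the extension is smooth across the boundary of the chart
  domain.\<close>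

lemma vector_field_with_value:
  fixes A :: "('a, 'n::finite) chart set"
  assumes M: "smooth_manifold M A" and p0: "p0 \<in> topspace M"
  obtains X where "vector_field A X" "X p0 = v"
proof -
  define c where "c = chart_at A p0"
  have c: "c \<in> A" "p0 \<in> fst c"
    using chart_at[OF M p0] by (auto simp: c_def)
  note ch = smooth_manifold_chart[OF M] and op = smooth_manifold_openin[OF M]
  have "open (snd c ` fst c)"
    using is_chart_open_image[OF ch[OF c(1)] op[OF c(1)]] by simp
  then obtain r where r: "r > 0" "cball (snd c p0) r \<subseteq> snd c ` fst c"
    using c(2) open_contains_cball by blast
  obtain \<phi> where \<phi>: "\<And>S. open S \<Longrightarrow> smooth_on S \<phi>" "\<phi> (snd c p0) = 1"
      "\<And>x. x \<notin> cball (snd c p0) r \<Longrightarrow> \<phi> x = (0::real)"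
    using bump_function[OF r(1)] by blast
  define X where "X p = (if p \<in> fst c then \<phi> (snd c p) *\<^sub>R coord_field A c v p else 0)" for p
  \<comment> \<open>Outside \<open>K\<close> the field vanishes. \<open>K\<close> is the preimage of
    a closed ball under a homeomorphism, hence compact.\<close>
  define K where "K = {p \<in> fst c. snd c p \<in> cball (snd c p0) r}"
  have imK: "snd c ` K = cball (snd c p0) r"
    using r(2) by (auto simp: K_def)
  have "compactin (subtopology M (fst c)) K"
  proof -
    have "topspace (subtopology M (fst c)) = fst c"
      using op[OF c(1)] openin_subset by fastforce
    then have "K \<subseteq> topspace (subtopology M (fst c))"
      by (auto simp: K_def)
    moreover have "compactin (top_of_set (snd c ` fst c)) (snd c ` K)"
      unfolding imK compactin_subtopology using r(2) by simp
    ultimately show ?thesis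
      using homeomorphic_map_compactness ch[OF c(1)] unfolding is_chart_def by metis
  qed
  then have "closedin M K"
    using M compactin_imp_closedin unfolding smooth_manifold_def compactin_subtopology by blast
  then have oK: "openin M (topspace M - K)" by blast
  \<comment> \<open>Two charts occur: \<open>d\<close> supplies the components of the field,
    \<open>e\<close> the coordinates of the point.\<close>
  have "smooth_on (snd e ` (fst e \<inter> fst d)) ((\<lambda>p. components A d p (X p)) \<circ> chart_inv e)"
    if d: "d \<in> A" and e: "e \<in> A" for d e
  proof (rule smooth_on_local)
    fix x assume "x \<in> snd e ` (fst e \<inter> fst d)"
    then obtain q where q: "q \<in> fst e" "q \<in> fst d" "x = snd e q" by auto
    \<comment> \<open>The domain of \<open>c\<close> and the complement of \<open>K\<close> are open
      and cover \<open>M\<close>, so it is enough to work inside one of them.\<close>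
    show "\<exists>U. open U \<and> x \<in> U \<and> smooth_on U ((\<lambda>p. components A d p (X p)) \<circ> chart_inv e)"
    proof (cases "q \<in> fst c")
      case True
      let ?U = "snd e ` (fst e \<inter> fst d \<inter> fst c)" and ?W = "snd c ` (fst c \<inter> fst d)"
      have U: "open ?U"
        by (rule is_chart_open_image[OF ch[OF e]]) (use op[OF c(1)] op[OF d] op[OF e] in auto)
      have W: "open ?W"
        by (rule is_chart_open_image[OF ch[OF c(1)]]) (use op[OF c(1)] op[OF d] op[OF e] in auto)
      have sub: "transition e c ` ?U \<subseteq> ?W"
        by (auto simp: transition_snd[OF ch[OF e]])
      have s: "smooth_on ?U (transition e c)"
        by (rule smooth_on_subset[OF smooth_on_transition[OF M e c(1)]]) auto
      \<comment> \<open>This is the field in coordinates: \<open>transition e c\<close> carries the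
        \<open>e\<close>-coordinates of the point to its \<open>c\<close>-coordinates, where the
        bump and the derivative of \<open>transition c d\<close> are evaluated.\<close>
      have "smooth_on ?U (\<lambda>x. \<phi> (transition e c x) *\<^sub>R
          frechet_derivative (transition c d) (at (transition e c x)) v)"
        by (intro smooth_on_scaleR U smooth_on_compose[OF U W sub \<phi>(1)[OF W] s]
            smooth_on_compose[OF U W sub smooth_on_deriv[OF smooth_on_transition[OF M c(1) d]] s])
      then have "smooth_on ?U ((\<lambda>p. components A d p (X p)) \<circ> chart_inv e)"
        by (rule smooth_on_cong[OF U, rotated])
          (auto simp: transition_snd[OF ch[OF e]] chart_inv_snd[OF ch[OF e]] X_def
            components_scaleR[OF M d] components_coord_field[OF M c(1) _ d])
      then show ?thesis using U True q by blast
    next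
      case False
      let ?U = "snd e ` (fst e \<inter> fst d \<inter> (topspace M - K))"
      have U: "open ?U"
        by (rule is_chart_open_image[OF ch[OF e]]) (use op[OF d] op[OF e] oK in auto)
      have "X p = 0" if "p \<notin> K" for p
        using that \<phi>(3) by (auto simp: X_def K_def)
      then have "smooth_on ?U ((\<lambda>p. components A d p (X p)) \<circ> chart_inv e)"
        by (intro smooth_on_cong[OF U _ smooth_on_const[of _ 0]])
          (auto simp: chart_inv_snd[OF ch[OF e]] components_zero[OF M d])
      moreover have "x \<in> ?U"
        using q False op[OF e] openin_subset by (fastforce simp: K_def)
      ultimately show ?thesis using U by blast
    qed
  qed
  then have "vector_field A X"
    unfolding vector_field_def smooth_fun_on_def by blast
  moreover have "X p0 = v"
    using c(2) \<phi>(2) coord_field_chart_at[OF M p0] by (simp add: X_def c_def)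
  ultimately show ?thesis by (rule that)
qed

lemma algebraic_gauss_equation_pointwise:
  assumes "smooth_manifold M A" "p \<in> topspace M" "algebraic_gauss_equation M A gB \<zeta> T"
  shows "T p x y z w = gB p (\<zeta> p x w) (\<zeta> p y z) - gB p (\<zeta> p x z) (\<zeta> p y w)"
proof -
  obtain X Y Z W where "vector_field A X" "X p = x" "vector_field A Y" "Y p = y"
      "vector_field A Z" "Z p = z" "vector_field A W" "W p = w"
    using vector_field_with_value[OF assms(1,2)] by metis
  then show ?thesis
    using assms(2,3) unfolding algebraic_gauss_equation_def by blast
qed


section \<open>Orthonormal bases\<close>

context
  fixes V :: "'v::real_vector set" and h :: "'v \<Rightarrow> 'v \<Rightarrow> real"
  assumes V: "subspace V" and h: "inner_product_on V h"
begin

lemma inner_product_on_sym: "x \<in> V \<Longrightarrow> y \<in> V \<Longrightarrow> h x y = h y x"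
  using h by (simp add: inner_product_on_def)

lemma inner_product_on_scale_left: "x \<in> V \<Longrightarrow> y \<in> V \<Longrightarrow> h (c *\<^sub>R x) y = c * h x y"
  using h by (simp add: inner_product_on_def)

lemma inner_product_on_scale_right: "x \<in> V \<Longrightarrow> y \<in> V \<Longrightarrow> h x (c *\<^sub>R y) = c * h x y"
  using inner_product_on_scale_left[of y x c] inner_product_on_sym[of x] V subspace_scale by metis

lemma inner_product_on_add_left: "x \<in> V \<Longrightarrow> y \<in> V \<Longrightarrow> z \<in> V \<Longrightarrow> h (x + y) z = h x z + h y z"
  using h by (simp add: inner_product_on_def)

lemma inner_product_on_add_right: "x \<in> V \<Longrightarrow> y \<in> V \<Longrightarrow> z \<in> V \<Longrightarrow> h x (y + z) = h x y + h x z"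
  using inner_product_on_add_left[of y z x] inner_product_on_sym[of x] V subspace_add by metis

lemma inner_product_on_zero_left: "z \<in> V \<Longrightarrow> h 0 z = 0"
  using inner_product_on_scale_left[of z z 0] by simp

lemma inner_product_on_zero_right: "z \<in> V \<Longrightarrow> h z 0 = 0"
  using inner_product_on_scale_right[of z z 0] by simp

lemma inner_product_on_diff_left: "x \<in> V \<Longrightarrow> y \<in> V \<Longrightarrow> z \<in> V \<Longrightarrow> h (x - y) z = h x z - h y z"
  using inner_product_on_add_left[of "x - y" y z] V subspace_diff by fastforce

lemma inner_product_on_pos: "x \<in> V \<Longrightarrow> x \<noteq> 0 \<Longrightarrow> h x x > 0"
  using h by (simp add: inner_product_on_def)

lemma inner_product_on_sum_left:
  assumes "\<And>i. i \<in> I \<Longrightarrow> u i \<in> V" "z \<in> V"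
  shows "h (\<Sum>i\<in>I. c i *\<^sub>R u i) z = (\<Sum>i\<in>I. c i * h (u i) z)"
  using assms(1)
proof (induction I rule: infinite_finite_induct)
  case (insert i I)
  have "(\<Sum>i\<in>I. c i *\<^sub>R u i) \<in> V"
    using V insert.prems by (intro subspace_sum subspace_scale) auto
  moreover have "c i *\<^sub>R u i \<in> V"
    using V insert.prems by (intro subspace_scale) auto
  ultimately show ?case
    using insert assms(2) by (simp add: inner_product_on_add_left inner_product_on_scale_left)
qed (simp_all add: inner_product_on_zero_left assms(2))

text \<open>Stated without a spanning condition, so that it also serves the Gram-Schmidt step, where
  the family spans only a proper subspace of \<open>V\<close>.\<close>

lemma orthonormal_inner_sum:
  assumes "finite I" "\<And>i. i \<in> I \<Longrightarrow> e i \<in> V"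
    "\<And>i j. i \<in> I \<Longrightarrow> j \<in> I \<Longrightarrow> h (e i) (e j) = (if i = j then 1 else 0)" "j \<in> I"
  shows "h (\<Sum>i\<in>I. c i *\<^sub>R e i) (e j) = c j"
proof -
  have "h (\<Sum>i\<in>I. c i *\<^sub>R e i) (e j) = (\<Sum>i\<in>I. c i * h (e i) (e j))"
    using assms by (intro inner_product_on_sum_left) auto
  also have "\<dots> = (\<Sum>i\<in>I. if i = j then c i else 0)"
    using assms by (intro sum.cong) auto
  finally show ?thesis using assms(1,4) by simp
qed

text \<open>The error \<open>y\<close> is orthogonal to each \<open>e i\<close>, hence to their span
  \<open>V\<close>, hence to itself; positivity gives \<open>y = 0\<close>.\<close>

lemma orthonormal_expansion:
  assumes e: "orthonormal_basis h V I e" and I: "finite I" and x: "x \<in> V"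
  shows "(\<Sum>i\<in>I. h x (e i) *\<^sub>R e i) = x"
proof -
  define y where "y = x - (\<Sum>i\<in>I. h x (e i) *\<^sub>R e i)"
  have eV: "\<And>i. i \<in> I \<Longrightarrow> e i \<in> V" and sp: "span (e ` I) = V"
    using e by (auto simp: orthonormal_basis_def)
  have s: "(\<Sum>i\<in>I. h x (e i) *\<^sub>R e i) \<in> V"
    using V eV by (intro subspace_sum subspace_scale) auto
  then have y: "y \<in> V"
    unfolding y_def using V x by (intro subspace_diff)
  have "h y (e i) = 0" if "i \<in> I" for i
  proof -
    have "h (\<Sum>i\<in>I. h x (e i) *\<^sub>R e i) (e i) = h x (e i)"
      using e that by (intro orthonormal_inner_sum I) (auto simp: orthonormal_basis_def)
    then show ?thesis
      using inner_product_on_diff_left[OF x s eV[OF that]] by (simp add: y_def)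
  qed
  moreover have "subspace {z \<in> V. h y z = 0}"
    using V y by (auto simp: subspace_def inner_product_on_zero_right inner_product_on_add_right inner_product_on_scale_right)
  ultimately have "span (e ` I) \<subseteq> {z \<in> V. h y z = 0}"
    using eV by (intro span_minimal) auto
  then have "h y y = 0" using y sp by auto
  then have "y = 0" using inner_product_on_pos[OF y] by fastforce
  then show ?thesis by (simp add: y_def)
qed

section \<open>Sums independent of the orthonormal basis\<close>

lemma parseval:
  assumes e: "orthonormal_basis h V I e" "finite I" and x: "x \<in> V" "y \<in> V"
  shows "(\<Sum>i\<in>I. h x (e i) * h y (e i)) = h x y"
proof -
  have eV: "\<And>i. i \<in> I \<Longrightarrow> e i \<in> V"
    using e by (auto simp: orthonormal_basis_def)
  have "h (\<Sum>i\<in>I. h x (e i) *\<^sub>R e i) y = (\<Sum>i\<in>I. h x (e i) * h (e i) y)"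
    using eV x by (intro inner_product_on_sum_left) auto
  then show ?thesis
    using orthonormal_expansion[OF e x(1)] inner_product_on_sym[OF x(2)] eV by simp
qed

text \<open>By Riesz representation the sum is the squared norm of \<open>L\<close>.\<close>

lemma sum_squares_linear_functional:
  assumes e: "orthonormal_basis h V I e" "finite I" and e': "orthonormal_basis h V J e'" "finite J"
    and l: "linear L"
  shows "(\<Sum>i\<in>I. (L (e i))\<^sup>2) = (\<Sum>j\<in>J. (L (e' j) :: real)\<^sup>2)"
proof -
  define z where "z = (\<Sum>i\<in>I. L (e i) *\<^sub>R e i)"
  have eV: "\<And>i. i \<in> I \<Longrightarrow> e i \<in> V"
    using e by (auto simp: orthonormal_basis_def)
  have z: "z \<in> V"
    unfolding z_def using V eV by (intro subspace_sum subspace_scale) auto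
  have riesz: "h z x = L x" if x: "x \<in> V" for x
  proof -
    have "L x = L (\<Sum>i\<in>I. h x (e i) *\<^sub>R e i)"
      using orthonormal_expansion[OF e x] by simp
    also have "\<dots> = (\<Sum>i\<in>I. L (e i) * h (e i) x)"
      using eV inner_product_on_sym[OF x] by (auto simp: linear_sum[OF l] linear_scale[OF l] intro!: sum.cong)
    also have "\<dots> = h z x"
      unfolding z_def using eV x by (intro inner_product_on_sum_left[symmetric]) auto
    finally show ?thesis ..
  qed
  have "(\<Sum>i\<in>K. (L (u i))\<^sup>2) = h z z" if u: "orthonormal_basis h V K u" "finite K" for K u
  proof -
    have "u i \<in> V" if "i \<in> K" for i
      using u that by (auto simp: orthonormal_basis_def)
    then show ?thesis
      using parseval[OF u z z] by (simp add: riesz power2_eq_square)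
  qed
  from this[OF e] this[OF e'] show ?thesis by simp
qed

text \<open>The basis is changed one slot at a time: with the other slot fixed, the form is a linear
  functional.\<close>

lemma sum_squares_bilinear_form:
  assumes e: "orthonormal_basis h V I e" "finite I" and e': "orthonormal_basis h V J e'" "finite J"
    and l: "\<And>x. linear (b x)" "\<And>y. linear (\<lambda>x. b x y)"
  shows "(\<Sum>i\<in>I. \<Sum>j\<in>I. (b (e i) (e j))\<^sup>2) = (\<Sum>i\<in>J. \<Sum>j\<in>J. (b (e' i) (e' j) :: real)\<^sup>2)"
proof -
  have "(\<Sum>i\<in>I. \<Sum>j\<in>I. (b (e i) (e j))\<^sup>2) = (\<Sum>i\<in>I. \<Sum>j\<in>J. (b (e i) (e' j))\<^sup>2)"
    by (intro sum.cong refl sum_squares_linear_functional e e' l)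
  also have "\<dots> = (\<Sum>j\<in>J. \<Sum>i\<in>I. (b (e i) (e' j))\<^sup>2)"
    by (rule sum.swap)
  also have "\<dots> = (\<Sum>j\<in>J. \<Sum>i\<in>J. (b (e' i) (e' j))\<^sup>2)"
    by (intro sum.cong refl sum_squares_linear_functional[where L = "\<lambda>x. b x (e' j)" for j] e e' l)
  also have "\<dots> = (\<Sum>i\<in>J. \<Sum>j\<in>J. (b (e' i) (e' j))\<^sup>2)"
    by (rule sum.swap)
  finally show ?thesis .
qed

text \<open>Expanding \<open>e i\<close> in the basis \<open>e'\<close> produces coefficients which,
  by symmetry of \<open>h\<close>, are those of \<open>e' j\<close> in the basis \<open>e\<close>;
  summing over \<open>i\<close> first reassembles \<open>e' j\<close>.\<close>

lemma trace_bilinear_form: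
  assumes e: "orthonormal_basis h V I e" "finite I" and e': "orthonormal_basis h V J e'" "finite J"
    and l: "\<And>x. linear (b x)" "\<And>y. linear (\<lambda>x. b x y)"
  shows "(\<Sum>i\<in>I. b (e i) (e i)) = (\<Sum>j\<in>J. b (e' j) (e' j) :: real)"
proof -
  have eV: "\<And>i. i \<in> I \<Longrightarrow> e i \<in> V" "\<And>j. j \<in> J \<Longrightarrow> e' j \<in> V"
    using e e' by (auto simp: orthonormal_basis_def)
  have "(\<Sum>i\<in>I. b (e i) (e i)) = (\<Sum>i\<in>I. b (\<Sum>j\<in>J. h (e i) (e' j) *\<^sub>R e' j) (e i))"
    by (intro sum.cong refl) (simp add: orthonormal_expansion[OF e' eV(1)])
  also have "\<dots> = (\<Sum>i\<in>I. \<Sum>j\<in>J. h (e i) (e' j) * b (e' j) (e i))"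
    by (simp add: linear_sum[OF l(2)] linear_scale[OF l(2)])
  also have "\<dots> = (\<Sum>j\<in>J. \<Sum>i\<in>I. h (e' j) (e i) * b (e' j) (e i))"
    by (subst sum.swap) (use eV inner_product_on_sym in \<open>auto intro!: sum.cong\<close>)
  also have "\<dots> = (\<Sum>j\<in>J. b (e' j) (\<Sum>i\<in>I. h (e' j) (e i) *\<^sub>R e i))"
    by (simp add: linear_sum[OF l(1)] linear_scale[OF l(1)])
  also have "\<dots> = (\<Sum>j\<in>J. b (e' j) (e' j))"
    by (intro sum.cong refl) (simp add: orthonormal_expansion[OF e eV(2)])
  finally show ?thesis .
qed

text \<open>One Gram-Schmidt step: \<open>y\<close> is the normalised difference of \<open>x\<close>
  and its projection to \<open>W\<close>, nonzero because \<open>x\<close> lies outside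
  \<open>W\<close>.\<close>

lemma orthonormal_basis_insert:
  assumes e: "orthonormal_basis h W I e" "finite I" "W \<subseteq> V" and x: "x \<in> V" "x \<notin> W" and j: "j \<notin> I"
  obtains y where "orthonormal_basis h (span (insert x W)) (insert j I) (e(j := y))"
proof -
  define w where "w = (\<Sum>i\<in>I. h x (e i) *\<^sub>R e i)"
  define z where "z = x - w"
  have eW: "\<And>i. i \<in> I \<Longrightarrow> e i \<in> W" and sp: "span (e ` I) = W"
    and orth: "\<And>i j. i \<in> I \<Longrightarrow> j \<in> I \<Longrightarrow> h (e i) (e j) = (if i = j then 1 else 0)"
    using e by (auto simp: orthonormal_basis_def)
  have eV: "\<And>i. i \<in> I \<Longrightarrow> e i \<in> V" using eW e(3) by blast
  have w: "w \<in> W"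
    unfolding w_def sp[symmetric] by (intro span_sum span_scale span_base) auto
  have wV: "w \<in> V" using w e(3) by blast
  have z: "z \<in> V" "z \<noteq> 0"
    using V x wV w by (auto simp: z_def intro: subspace_diff)
  have ze: "h z (e i) = 0" if "i \<in> I" for i
    using inner_product_on_diff_left[OF x(1) wV eV[OF that]]
      orthonormal_inner_sum[OF e(2) eV orth that, of "\<lambda>i. h x (e i)"]
    by (simp add: z_def w_def)
  define s where "s = sqrt (h z z)"
  have s: "s > 0" "s * s = h z z"
    using inner_product_on_pos[OF z] by (auto simp: s_def)
  define y where "y = (1 / s) *\<^sub>R z"
  have y: "y \<in> V" using V z by (simp add: y_def subspace_scale)
  have yy: "h y y = 1"
    using s z(1) y by (simp add: y_def inner_product_on_scale_left inner_product_on_scale_right s(2)[symmetric])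
  have ye: "h y (e i) = 0" "h (e i) y = 0" if "i \<in> I" for i
    using ze[OF that] inner_product_on_scale_left[OF z(1) eV[OF that]] inner_product_on_sym[OF y eV[OF that]]
    by (auto simp: y_def)
  have x_eq: "x = w + s *\<^sub>R y"
    using s(1) by (simp add: y_def z_def)
  have "span (insert y (e ` I)) = span (insert x W)"
  proof (subst span_eq, intro conjI)
    have W: "W \<subseteq> span (insert y (e ` I))"
      unfolding sp[symmetric] by (intro span_mono) auto
    have "x \<in> span (insert y (e ` I))"
      unfolding x_eq using W w by (intro span_add span_scale span_base[of y]) auto
    then show "insert x W \<subseteq> span (insert y (e ` I))" using W by auto
    have "y \<in> span (insert x W)"
      unfolding y_def z_def using w by (intro span_scale span_diff span_base) auto
    then show "insert y (e ` I) \<subseteq> span (insert x W)"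
      using eW span_superset by blast
  qed
  moreover have im: "(e(j := y)) ` insert j I = insert y (e ` I)"
    using j by auto
  moreover have "y \<in> span (insert y (e ` I))" "\<And>i. i \<in> I \<Longrightarrow> e i \<in> span (insert y (e ` I))"
    by (auto intro: span_base)
  ultimately have "orthonormal_basis h (span (insert x W)) (insert j I) (e(j := y))"
    unfolding orthonormal_basis_def using orth j yy ye by auto
  then show ?thesis by (rule that)
qed

text \<open>Gram-Schmidt, one index \<open>j\<close> of \<open>I\<close> being set aside for each
  new vector. The index set is arbitrary because tangent bases are numbered from 1 and fibre bases
  from \<open>n+1\<close>.\<close>

lemma orthonormal_basis_exists:
  assumes "finite S" "independent S" "S \<subseteq> V" "finite I" "card I = card S"
  shows "\<exists>e. orthonormal_basis h (span S) I e"
  using assms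
proof (induction S arbitrary: I rule: finite_induct)
  case empty
  then show ?case by (simp add: orthonormal_basis_def)
next
  case (insert x S)
  then obtain j where j: "j \<in> I"
    by (metis card.empty card_insert_disjoint equals0I nat.distinct(1))
  have x: "independent S" "x \<notin> span S"
    using insert.prems(1) insert.hyps(2) by (auto simp: independent_insert)
  obtain e where e: "orthonormal_basis h (span S) (I - {j}) e"
    using insert.IH[of "I - {j}"] insert.prems insert.hyps x(1) j by auto
  have "span S \<subseteq> V"
    using insert.prems(2) V by (intro span_minimal) auto
  then obtain y where "orthonormal_basis h (span (insert x (span S))) (insert j (I - {j})) (e(j := y))"
    using orthonormal_basis_insert[OF e, of x j] insert.prems x by auto
  moreover have "span (insert x (span S)) = span (insert x S)"
    by (simp add: span_eq)
      (meson insert_subset span_base span_mono span_superset subset_insertI subset_trans insertI1)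
  moreover have "insert j (I - {j}) = I" using j by auto
  ultimately show ?case by auto
qed

end

section \<open>Sums over square arrays\<close>

text \<open>Passes from the sum over pairs i < j in the scalar curvature to full double sums, where
  traces and squared norms appear.\<close>

lemma sum_sum_symmetric:
  fixes F :: "nat \<Rightarrow> nat \<Rightarrow> real"
  assumes "\<And>i j. F i j = F j i" "\<And>i. F i i = 0"
  shows "(\<Sum>i=1..n. \<Sum>j=1..n. F i j) = 2 * (\<Sum>j=1..n. \<Sum>i=1..<j. F i j)"
proof (induction n)
  case (Suc n)
  have "(\<Sum>i=1..Suc n. \<Sum>j=1..Suc n. F i j) =
      (\<Sum>i=1..n. \<Sum>j=1..n. F i j) + (\<Sum>i=1..n. F i (Suc n)) + (\<Sum>j=1..n. F (Suc n) j)"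
    by (simp add: sum.distrib assms(2))
  also have "(\<Sum>j=1..n. F (Suc n) j) = (\<Sum>i=1..n. F i (Suc n))"
    using assms(1) by (intro sum.cong refl)
  finally show ?case
    using Suc.IH by (simp add: atLeastLessThanSuc_atLeastAtMost)
qed simp

lemma sum_square_array_split:
  fixes b :: "nat \<Rightarrow> nat \<Rightarrow> real"
  shows "(\<Sum>i=1..n. \<Sum>j=1..n. (b i j)\<^sup>2) =
    (\<Sum>i=1..n. (b i i)\<^sup>2) + (\<Sum>i=1..n. \<Sum>j=1..n. if i = j then 0 else (b i j)\<^sup>2)"
proof -
  have "(\<Sum>j=1..n. (b i j)\<^sup>2) = (b i i)\<^sup>2 + (\<Sum>j=1..n. if i = j then 0 else (b i j)\<^sup>2)"
    if "i \<in> {1..n}" for i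
  proof -
    have "(\<Sum>j=1..n. (b i j)\<^sup>2) =
        (\<Sum>j=1..n. (if i = j then (b i i)\<^sup>2 else 0) + (if i = j then 0 else (b i j)\<^sup>2))"
      by (intro sum.cong) auto
    then show ?thesis using that by (simp add: sum.distrib)
  qed
  then show ?thesis by (simp add: sum.distrib)
qed

text \<open>With \<open>d i = b i i - b n n / 2\<close> the diagonal part of the difference is
  \<open>(n + 1) * (\<Sum>i<n. (d i)\<^sup>2) - (\<Sum>i<n. d i)\<^sup>2\<close>, which Cauchy-Schwarz bounds from below.\<close>

lemma trace_square_gap:
  fixes b :: "nat \<Rightarrow> nat \<Rightarrow> real"
  assumes n: "n = Suc N"
  shows "2 * (\<Sum>i=1..N. (b i i - b n n / 2)\<^sup>2) + (\<Sum>i=1..n. \<Sum>j=1..n. if i = j then 0 else (b i j)\<^sup>2) \<le>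
    (real n + 1) / 2 * ((\<Sum>i=1..n. \<Sum>j=1..n. (b i j)\<^sup>2) + (\<Sum>i=1..N. \<Sum>j=1..N. (b i j)\<^sup>2))
      - (\<Sum>i=1..n. b i i)\<^sup>2"
proof -
  define c where "c = b n n"
  define d where "d i = b i i - c / 2" for i
  define off where "off k = (\<Sum>i=1..k. \<Sum>j=1..k. if i = j then 0 else (b i j)\<^sup>2)" for k
  have off: "off k \<ge> 0" for k
    unfolding off_def by (intro sum_nonneg) auto
  define s1 where "s1 = (\<Sum>i=1..N. d i)"
  define s2 where "s2 = (\<Sum>i=1..N. (d i)\<^sup>2)"
  have split: "(\<Sum>i=1..n. b i i) = (\<Sum>i=1..N. b i i) + c"
      "(\<Sum>i=1..n. (b i i)\<^sup>2) = (\<Sum>i=1..N. (b i i)\<^sup>2) + c\<^sup>2"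
    by (simp_all add: n c_def)
  have bd: "b i i = d i + c / 2" for i by (simp add: d_def)
  have tr: "(\<Sum>i=1..N. b i i) = s1 + real N * c / 2"
    by (simp add: bd s1_def sum.distrib)
  have "(d i + c / 2)\<^sup>2 = (d i)\<^sup>2 + c * d i + c\<^sup>2 / 4" for i
    by (simp add: power2_eq_square algebra_simps)
  then have sq: "(\<Sum>i=1..N. (b i i)\<^sup>2) = s2 + c * s1 + real N * c\<^sup>2 / 4"
    by (simp add: bd s1_def s2_def sum.distrib sum_distrib_left)
  have cs: "s1\<^sup>2 \<le> real N * s2"
    using Cauchy_Schwarz_ineq_sum[of "\<lambda>_. 1" d "{1..N}"] by (simp add: s1_def s2_def)
  have "(real n + 1) / 2 * ((\<Sum>i=1..n. \<Sum>j=1..n. (b i j)\<^sup>2) + (\<Sum>i=1..N. \<Sum>j=1..N. (b i j)\<^sup>2))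
      - (\<Sum>i=1..n. b i i)\<^sup>2 =
      (real N + 2) / 2 * (2 * (s2 + c * s1 + real N * c\<^sup>2 / 4) + c\<^sup>2 + off n + off N)
      - (s1 + real N * c / 2 + c)\<^sup>2"
    unfolding sum_square_array_split off_def[symmetric] split sq tr
    by (simp add: n algebra_simps)
  \<comment> \<open>All terms in \<open>c\<close> cancel; this is what dictates both the shift by
    \<open>c / 2\<close> and the weight (n + 1) / 2.\<close>
  also have "\<dots> = (real N + 2) * s2 - s1\<^sup>2 + (real N + 2) / 2 * (off n + off N)"
    by (simp add: field_simps power2_eq_square)
  \<comment> \<open>Cauchy-Schwarz absorbs only N of the N + 2 copies of \<open>s2\<close>, and the
    weight on the off-diagonal part is at least 1. The positive remainder is what later forces the
    equality case.\<close>
  also have "\<dots> \<ge> 2 * s2 + off n"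
  proof -
    have "(real N + 2) / 2 * (off n + off N) = off n + off N + real N / 2 * (off n + off N)"
      by (simp add: field_simps)
    moreover have "real N / 2 * (off n + off N) \<ge> 0"
      using off by (intro mult_nonneg_nonneg add_nonneg_nonneg) auto
    moreover have "(real N + 2) * s2 = real N * s2 + 2 * s2"
      by (simp add: distrib_right)
    ultimately show ?thesis using cs off[of N] by linarith
  qed
  finally show ?thesis
    by (simp add: s2_def off_def d_def c_def)
qed

text \<open>With c = b n n the trace is (N + 2) c / 2 and the two sums of squares add up to (N + 2)
  c^2 / 2, so both sides equal (N + 2)^2 c^2 / 4.\<close>

lemma trace_square_gap_eq_0:
  fixes b :: "nat \<Rightarrow> nat \<Rightarrow> real"
  assumes n: "n = Suc N"
    and off: "\<And>i j. i \<in> {1..n} \<Longrightarrow> j \<in> {1..n} \<Longrightarrow> i \<noteq> j \<Longrightarrow> b i j = 0"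
    and diag: "\<And>i. i \<in> {1..N} \<Longrightarrow> b i i = 1 / 2 * b n n"
  shows "(real n + 1) / 2 * ((\<Sum>i=1..n. \<Sum>j=1..n. (b i j)\<^sup>2) + (\<Sum>i=1..N. \<Sum>j=1..N. (b i j)\<^sup>2))
      - (\<Sum>i=1..n. b i i)\<^sup>2 = 0"
proof -
  define c where "c = b n n"
  have z: "(\<Sum>i=1..k. \<Sum>j=1..k. if i = j then 0 else (b i j)\<^sup>2) = 0" if "k \<le> n" for k
    using off that by (intro sum.neutral ballI) auto
  have split: "(\<Sum>i=1..n. b i i) = (\<Sum>i=1..N. b i i) + c"
      "(\<Sum>i=1..n. (b i i)\<^sup>2) = (\<Sum>i=1..N. (b i i)\<^sup>2) + c\<^sup>2"
    by (simp_all add: n c_def)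
  have tr: "(\<Sum>i=1..N. b i i) = real N * c / 2"
    by (simp add: diag c_def)
  have sq: "(\<Sum>i=1..N. (b i i)\<^sup>2) = real N * c\<^sup>2 / 4"
    by (simp add: diag c_def power2_eq_square)
  show ?thesis
    unfolding sum_square_array_split z[OF order_refl] z[of N, unfolded n, OF le_SucI[OF order_refl]] split sq tr
    by (simp add: n field_simps power2_eq_square)
qed


section \<open>Scalar and Casorati curvatures at a point\<close>

lemma orthonormal_basis_UNIV_hyperplane:
  fixes e :: "nat \<Rightarrow> real ^ 'n::finite"
  assumes e: "orthonormal_basis h UNIV {1..n} e" and n: "n = CARD('n)" "n = Suc N"
  shows "dim (span (e ` {1..N})) = N" "orthonormal_basis h (span (e ` {1..N})) {1..N} e"
proof -
  have sp: "span (e ` {1..n}) = UNIV"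
    using e by (simp add: orthonormal_basis_def)
  have "card (e ` {1..n}) \<le> n"
    using card_image_le[of "{1..n}" e] by simp
  moreover have "dim (e ` {1..n}) = n"
    by (metis dim_UNIV dim_span sp n(1) DIM_cart DIM_real mult.right_neutral)
  moreover have "dim (e ` {1..n}) \<le> card (e ` {1..n})"
    by (simp add: dim_le_card')
  ultimately have c: "card (e ` {1..n}) = n" by simp
  then have "inj_on e {1..n}"
    by (simp add: eq_card_imp_inj_on)
  then have "inj_on e {1..N}"
    by (rule inj_on_subset) (simp add: n(2))
  then have card: "card (e ` {1..N}) = N"
    by (simp add: card_image)
  have "independent (e ` {1..n})"
    using c n(1) sp by (intro card_le_dim_spanning[of _ UNIV]) auto
  then have "independent (e ` {1..N})"
    by (rule independent_mono) (use n(2) in auto)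
  then show "dim (span (e ` {1..N})) = N"
    using card by (simp add: dim_eq_card_independent)
  show "orthonormal_basis h (span (e ` {1..N})) {1..N} e"
    using e n(2) by (auto simp: orthonormal_basis_def intro: span_base)
qed

lemma orthonormal_basis_subspace_exists:
  fixes P :: "(real ^ 'n::finite) set"
  assumes h: "inner_product_on UNIV h" and P: "subspace P"
  shows "\<exists>e. orthonormal_basis h P {1..dim P} e"
proof -
  obtain S where S: "S \<subseteq> P" "independent S" "P \<subseteq> span S" "card S = dim P"
    using basis_exists by blast
  have "span S = P"
    using S(1,3) P by (meson span_minimal subset_antisym)
  then show ?thesis
    using orthonormal_basis_exists[OF subspace_UNIV h _ S(2), of "{1..dim P}"] S
    by (simp add: independent_imp_finite)
qed

text \<open>One Gram-Schmidt step applied to any vector outside \<open>P\<close>; a dimension count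
  shows that the result spans everything. The new vector gets the last index \<open>n\<close>, so
  \<open>e n\<close> is the normal of \<open>P\<close>.\<close>

lemma orthonormal_basis_adapted_to_hyperplane:
  fixes P :: "(real ^ 'n::finite) set"
  assumes h: "inner_product_on UNIV h" and P: "P \<in> hyperplanes" and n: "n = CARD('n)" "n = Suc N"
  obtains e where "orthonormal_basis h UNIV {1..n} e" "span (e ` {1..N}) = P"
proof -
  have sP: "subspace P" and dP: "dim P = N"
    using P n by (auto simp: hyperplanes_def)
  obtain e where e: "orthonormal_basis h P {1..N} e"
    using orthonormal_basis_subspace_exists[OF h sP] dP by auto
  have "dim P < dim (UNIV :: (real ^ 'n) set)"
    using dP n by (simp add: dim_UNIV)
  then have "P \<noteq> UNIV"
    by auto
  then obtain x where x: "x \<notin> P"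
    by blast
  obtain y where y: "orthonormal_basis h (span (insert x P)) (insert n {1..N}) (e(n := y))"
    using orthonormal_basis_insert[OF subspace_UNIV h e _ _ _ x, of n] n(2) by auto
  have "dim (insert x P) = n"
    using x sP dP n(2) by (simp add: dim_insert span_eq_iff[THEN iffD2])
  then have "span (insert x P) = UNIV"
    by (metis dim_eq_full n(1) DIM_cart DIM_real mult.right_neutral)
  moreover have "insert n {1..N} = {1..n}"
    using n(2) by auto
  ultimately have "orthonormal_basis h UNIV {1..n} (e(n := y))"
    using y by simp
  moreover have "(e(n := y)) ` {1..N} = e ` {1..N}"
    using n(2) by auto
  then have "span ((e(n := y)) ` {1..N}) = P"
    using e by (simp add: orthonormal_basis_def)
  ultimately show ?thesis by (rule that)
qed

text \<open>The data at a single point \<open>p\<close>, with the Gauss equation already available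
  for all tangent vectors. The parameters remain families over points since the curvature
  definitions take families.\<close>

locale gauss_point =
  fixes g :: "'a \<Rightarrow> real ^ 'n::finite \<Rightarrow> real ^ 'n \<Rightarrow> real"
    and B :: "'a \<Rightarrow> 'b::real_vector set"
    and gB :: "'a \<Rightarrow> 'b \<Rightarrow> 'b \<Rightarrow> real"
    and \<zeta> :: "'a \<Rightarrow> real ^ 'n \<Rightarrow> real ^ 'n \<Rightarrow> 'b"
    and T :: "'a \<Rightarrow> real ^ 'n \<Rightarrow> real ^ 'n \<Rightarrow> real ^ 'n \<Rightarrow> real ^ 'n \<Rightarrow> real"
    and p :: 'a and J :: "nat set"
  assumes J: "finite J"
    and g: "inner_product_on UNIV (g p)"
    and B: "subspace (B p)"
    and gB: "inner_product_on (B p) (gB p)"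
    and frame: "\<exists>f. orthonormal_basis (gB p) (B p) J f"
    and \<zeta>_bilinear: "bilinear (\<zeta> p)"
    and \<zeta>_sym: "\<zeta> p x y = \<zeta> p y x"
    and \<zeta>_B: "\<zeta> p x y \<in> B p"
    and gauss: "T p x y z w = gB p (\<zeta> p x w) (\<zeta> p y z) - gB p (\<zeta> p x z) (\<zeta> p y w)"
begin

section \<open>Curvatures expressed by components in arbitrary orthonormal bases\<close>

lemma linear_component:
  assumes "b \<in> B p"
  shows "linear (\<lambda>y. gB p (\<zeta> p x y) b)" "linear (\<lambda>x. gB p (\<zeta> p x y) b)"
proof -
  note rules = inner_product_on_add_left[OF B gB] inner_product_on_scale_left[OF B gB] \<zeta>_B assms
  show "linear (\<lambda>y. gB p (\<zeta> p x y) b)"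
    using \<zeta>_bilinear by (intro linearI)
      (simp_all add: bilinear_radd bilinear_rmul rules)
  show "linear (\<lambda>x. gB p (\<zeta> p x y) b)"
    using \<zeta>_bilinear by (intro linearI)
      (simp_all add: bilinear_ladd bilinear_lmul rules)
qed

text \<open>Parseval in the fibre removes \<open>f\<close> from the right-hand side, so the
  left-hand side is the same for every fibre basis.\<close>

lemma sum_squares_components:
  assumes "orthonormal_basis (gB p) (B p) J f"
  shows "(\<Sum>\<alpha>\<in>J. \<Sum>i\<in>I. \<Sum>j\<in>I. (gB p (\<zeta> p (e i) (e j)) (f \<alpha>))\<^sup>2) =
    (\<Sum>i\<in>I. \<Sum>j\<in>I. gB p (\<zeta> p (e i) (e j)) (\<zeta> p (e i) (e j)))"
proof -
  have "(\<Sum>\<alpha>\<in>J. \<Sum>i\<in>I. \<Sum>j\<in>I. (gB p (\<zeta> p (e i) (e j)) (f \<alpha>))\<^sup>2) =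
      (\<Sum>i\<in>I. \<Sum>j\<in>I. \<Sum>\<alpha>\<in>J. (gB p (\<zeta> p (e i) (e j)) (f \<alpha>))\<^sup>2)"
    by (subst sum.swap, rule sum.cong[OF refl], rule sum.swap)
  then show ?thesis
    by (simp add: power2_eq_square parseval[OF B gB assms J \<zeta>_B \<zeta>_B])
qed

text \<open>Frees the definition from its \<open>SOME\<close> bases: the tangent basis is exchanged
  in each normal component, the fibre basis through the squared norm.\<close>

lemma casorati_eq:
  assumes P: "subspace P" and e: "orthonormal_basis (g p) P {1..dim P} e"
    and f: "orthonormal_basis (gB p) (B p) J f"
  shows "casorati g J B gB \<zeta> p P =
    1 / real (dim P) * (\<Sum>\<alpha>\<in>J. \<Sum>i=1..dim P. \<Sum>j=1..dim P. (gB p (\<zeta> p (e i) (e j)) (f \<alpha>))\<^sup>2)"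
proof -
  define e' where "e' = (SOME e. orthonormal_basis (g p) P {1..dim P} e)"
  define f' where "f' = (SOME f. orthonormal_basis (gB p) (B p) J f)"
  have e': "orthonormal_basis (g p) P {1..dim P} e'"
    unfolding e'_def using someI[of "\<lambda>e. orthonormal_basis (g p) P {1..dim P} e", OF e] .
  have f': "orthonormal_basis (gB p) (B p) J f'"
    unfolding f'_def using someI[of "\<lambda>f. orthonormal_basis (gB p) (B p) J f", OF f] .
  have gP: "inner_product_on P (g p)"
    using g unfolding inner_product_on_def by blast
  have "f \<alpha> \<in> B p" if "\<alpha> \<in> J" for \<alpha>
    using f that by (simp add: orthonormal_basis_def)
  then have "(\<Sum>i=1..dim P. \<Sum>j=1..dim P. (gB p (\<zeta> p (e' i) (e' j)) (f \<alpha>))\<^sup>2) =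
      (\<Sum>i=1..dim P. \<Sum>j=1..dim P. (gB p (\<zeta> p (e i) (e j)) (f \<alpha>))\<^sup>2)" if "\<alpha> \<in> J" for \<alpha>
    using sum_squares_bilinear_form[OF P gP e' _ e _ linear_component] that by simp
  then have "(\<Sum>\<alpha>\<in>J. \<Sum>i=1..dim P. \<Sum>j=1..dim P. (gB p (\<zeta> p (e' i) (e' j)) (f' \<alpha>))\<^sup>2) =
      (\<Sum>\<alpha>\<in>J. \<Sum>i=1..dim P. \<Sum>j=1..dim P. (gB p (\<zeta> p (e i) (e j)) (f \<alpha>))\<^sup>2)"
    unfolding sum_squares_components[OF f'] sum_squares_components[OF f, symmetric] by simp
  then show ?thesis
    by (simp add: casorati_def Let_def e'_def f'_def)
qed

text \<open>The Gauss equation at (e i, e j, e j, e i) gives, in each normal direction, a product of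
  diagonal entries minus a squared entry. Summed over all i and j this is the squared trace minus
  the squared norm, both independent of the basis.\<close>

lemma scalar_curvature_eq:
  assumes e: "orthonormal_basis (g p) UNIV {1..CARD('n)} e"
    and f: "orthonormal_basis (gB p) (B p) J f"
  shows "2 * scalar_curvature g T p =
    (\<Sum>\<alpha>\<in>J. (\<Sum>i=1..CARD('n). gB p (\<zeta> p (e i) (e i)) (f \<alpha>))\<^sup>2
      - (\<Sum>i=1..CARD('n). \<Sum>j=1..CARD('n). (gB p (\<zeta> p (e i) (e j)) (f \<alpha>))\<^sup>2))"
proof -
  define e' where "e' = (SOME e. orthonormal_basis (g p) UNIV {1..CARD('n)} e)"
  have e': "orthonormal_basis (g p) UNIV {1..CARD('n)} e'"
    unfolding e'_def using someI[of "\<lambda>e. orthonormal_basis (g p) UNIV {1..CARD('n)} e", OF e] .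
  define b where "b \<alpha> x y = gB p (\<zeta> p x y) (f \<alpha>)" for \<alpha> x y
  have lin: "linear (b \<alpha> x)" "linear (\<lambda>x. b \<alpha> x y)" if "\<alpha> \<in> J" for \<alpha> x y
    unfolding b_def using f that by (auto simp: orthonormal_basis_def intro!: linear_component)
  define F where "F i j = (\<Sum>\<alpha>\<in>J. b \<alpha> (e' i) (e' i) * b \<alpha> (e' j) (e' j) - (b \<alpha> (e' i) (e' j))\<^sup>2)"
    for i j
  have T: "T p (e' i) (e' j) (e' j) (e' i) = F i j" for i j
    by (simp add: gauss F_def b_def sum_subtractf power2_eq_square \<zeta>_sym[of "e' j" "e' i"]
        parseval[OF B gB f J \<zeta>_B \<zeta>_B])
  have "2 * scalar_curvature g T p = 2 * (\<Sum>j=1..CARD('n). \<Sum>i=1..<j. F i j)"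
    unfolding scalar_curvature_def Let_def e'_def[symmetric] T ..
  also have "\<dots> = (\<Sum>i=1..CARD('n). \<Sum>j=1..CARD('n). F i j)"
    by (rule sum_sum_symmetric[symmetric])
      (auto simp: F_def b_def \<zeta>_sym power2_eq_square mult.commute intro!: sum.cong)
  also have "\<dots> = (\<Sum>\<alpha>\<in>J. \<Sum>i=1..CARD('n). \<Sum>j=1..CARD('n).
      b \<alpha> (e' i) (e' i) * b \<alpha> (e' j) (e' j) - (b \<alpha> (e' i) (e' j))\<^sup>2)"
    unfolding F_def by (subst (2) sum.swap, rule trans[OF sum.cong[OF refl sum.swap]]) (rule refl)
  also have "\<dots> = (\<Sum>\<alpha>\<in>J. (\<Sum>i=1..CARD('n). b \<alpha> (e' i) (e' i))\<^sup>2
      - (\<Sum>i=1..CARD('n). \<Sum>j=1..CARD('n). (b \<alpha> (e' i) (e' j))\<^sup>2))"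
    by (simp add: sum_subtractf power2_eq_square sum_product)
  also have "\<dots> = (\<Sum>\<alpha>\<in>J. (\<Sum>i=1..CARD('n). b \<alpha> (e i) (e i))\<^sup>2
      - (\<Sum>i=1..CARD('n). \<Sum>j=1..CARD('n). (b \<alpha> (e i) (e j))\<^sup>2))"
    using sum_squares_bilinear_form[OF subspace_UNIV g e' _ e _ lin]
      trace_bilinear_form[OF subspace_UNIV g e' _ e _ lin]
    by (intro sum.cong) auto
  finally show ?thesis by (simp add: b_def)
qed

text \<open>Over the common denominator n N, the sum \<open>D\<close> receives N / 2 from its
  Casorati term and 1 from the scalar curvature, in total (n + 1) / 2. This is also the weight of
  \<open>D'\<close>, as the trace estimate requires.\<close>

lemma casorati_gap:
  assumes e: "orthonormal_basis (g p) UNIV {1..n} e"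
    and f: "orthonormal_basis (gB p) (B p) J f"
    and n: "n = CARD('n)" "n = Suc N" "N > 0"
  defines "P \<equiv> span (e ` {1..N})" and "b \<equiv> \<lambda>\<alpha> i j. gB p (\<zeta> p (e i) (e j)) (f \<alpha>)"
  shows "1 / 2 * casorati g J B gB \<zeta> p UNIV + (real n + 1) / (2 * real n) * casorati g J B gB \<zeta> p P
      - normalized_scalar_curvature g T p =
    1 / (real n * real N) * (\<Sum>\<alpha>\<in>J.
      (real n + 1) / 2 * ((\<Sum>i=1..n. \<Sum>j=1..n. (b \<alpha> i j)\<^sup>2) + (\<Sum>i=1..N. \<Sum>j=1..N. (b \<alpha> i j)\<^sup>2))
      - (\<Sum>i=1..n. b \<alpha> i i)\<^sup>2)"
proof -
  note P = orthonormal_basis_UNIV_hyperplane[OF e n(1,2), folded P_def]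
  define D where "D = (\<Sum>\<alpha>\<in>J. \<Sum>i=1..n. \<Sum>j=1..n. (b \<alpha> i j)\<^sup>2)"
  define D' where "D' = (\<Sum>\<alpha>\<in>J. \<Sum>i=1..N. \<Sum>j=1..N. (b \<alpha> i j)\<^sup>2)"
  define t where "t = (\<Sum>\<alpha>\<in>J. (\<Sum>i=1..n. b \<alpha> i i)\<^sup>2)"
  have U: "dim (UNIV :: (real ^ 'n) set) = n"
    using n(1) by (simp add: dim_UNIV)
  have c: "casorati g J B gB \<zeta> p UNIV = D / n"
    using casorati_eq[OF subspace_UNIV, unfolded U, OF e f] by (simp add: D_def b_def)
  have c': "casorati g J B gB \<zeta> p P = D' / N"
    using casorati_eq[of P, unfolded P(1), OF _ P(2) f] by (simp add: D'_def b_def P_def)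
  have "2 * scalar_curvature g T p = t - D"
    using scalar_curvature_eq[OF e[unfolded n(1)] f]
    by (simp add: t_def D_def b_def sum_subtractf n(1))
  then have s: "normalized_scalar_curvature g T p = (t - D) / (real n * real N)"
    by (simp add: normalized_scalar_curvature_def n(1)[symmetric] n(2))
  have "1 / 2 * casorati g J B gB \<zeta> p UNIV + (real n + 1) / (2 * real n) * casorati g J B gB \<zeta> p P
      - normalized_scalar_curvature g T p = 1 / (real n * real N) * ((real n + 1) / 2 * (D + D') - t)"
    unfolding c c' s using n(2,3) by (simp add: divide_simps) (simp add: algebra_simps)
  then show ?thesis
    by (simp add: D_def D'_def t_def sum_subtractf sum.distrib sum_distrib_left distrib_left)
qed

section \<open>The inequality and its equality case at a point\<close>

lemma casorati_nonneg: "casorati g J B gB \<zeta> p P \<ge> 0"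
  unfolding casorati_def Let_def by (intro mult_nonneg_nonneg sum_nonneg) auto

lemma bdd_below_casorati: "bdd_below (casorati g J B gB \<zeta> p ` X)"
  using casorati_nonneg by (intro bdd_belowI2)

text \<open>Both parts concern a fixed hyperplane \<open>P\<close>, so an infimum attained at
  \<open>P\<close> can be substituted directly. The tangent basis must be adapted to
  \<open>P\<close>, whereas the fibre basis is arbitrary.\<close>

lemma normalized_scalar_curvature_le:
  assumes n: "n = CARD('n)" "n = Suc N" "N > 0" and P: "P \<in> hyperplanes"
  shows "normalized_scalar_curvature g T p \<le>
    1 / 2 * casorati g J B gB \<zeta> p UNIV + (real n + 1) / (2 * real n) * casorati g J B gB \<zeta> p P"
    and "normalized_scalar_curvature g T p =
        1 / 2 * casorati g J B gB \<zeta> p UNIV + (real n + 1) / (2 * real n) * casorati g J B gB \<zeta> p P \<Longrightarrow>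
      \<exists>e f. orthonormal_basis (g p) UNIV {1..n} e \<and> orthonormal_basis (gB p) (B p) J f \<and>
        (\<forall>i\<in>{1..n}. \<forall>j\<in>{1..n}. \<forall>\<alpha>\<in>J. i \<noteq> j \<longrightarrow> gB p (\<zeta> p (e i) (e j)) (f \<alpha>) = 0) \<and>
        (\<forall>\<alpha>\<in>J. \<forall>i\<in>{1..N}.
           gB p (\<zeta> p (e i) (e i)) (f \<alpha>) = 1 / 2 * gB p (\<zeta> p (e n) (e n)) (f \<alpha>))"
proof -
  let ?R = "1 / 2 * casorati g J B gB \<zeta> p UNIV + (real n + 1) / (2 * real n) * casorati g J B gB \<zeta> p P"
  obtain e where e: "orthonormal_basis (g p) UNIV {1..n} e" "span (e ` {1..N}) = P"
    using orthonormal_basis_adapted_to_hyperplane[OF g P n(1,2)] .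
  obtain f where f: "orthonormal_basis (gB p) (B p) J f"
    using frame by blast
  define b where "b \<alpha> i j = gB p (\<zeta> p (e i) (e j)) (f \<alpha>)" for \<alpha> i j
  define gap where "gap \<alpha> = (real n + 1) / 2 *
      ((\<Sum>i=1..n. \<Sum>j=1..n. (b \<alpha> i j)\<^sup>2) + (\<Sum>i=1..N. \<Sum>j=1..N. (b \<alpha> i j)\<^sup>2))
      - (\<Sum>i=1..n. b \<alpha> i i)\<^sup>2" for \<alpha>
  define diag where "diag \<alpha> = (\<Sum>i=1..N. (b \<alpha> i i - b \<alpha> n n / 2)\<^sup>2)" for \<alpha>
  define off where "off \<alpha> = (\<Sum>i=1..n. \<Sum>j=1..n. if i = j then 0 else (b \<alpha> i j)\<^sup>2)" for \<alpha>
  have le: "2 * diag \<alpha> + off \<alpha> \<le> gap \<alpha>" for \<alpha>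
    unfolding diag_def off_def gap_def by (rule trace_square_gap[OF n(2)])
  have pos: "diag \<alpha> \<ge> 0" "off \<alpha> \<ge> 0" for \<alpha>
    unfolding diag_def off_def by (intro sum_nonneg; simp)+
  have gap: "gap \<alpha> \<ge> 0" for \<alpha>
    using le[of \<alpha>] pos[of \<alpha>] by linarith
  have eq: "?R - normalized_scalar_curvature g T p = 1 / (real n * real N) * (\<Sum>\<alpha>\<in>J. gap \<alpha>)"
    unfolding gap_def b_def using casorati_gap[OF e(1) f n] unfolding e(2) .
  have "1 / (real n * real N) * (\<Sum>\<alpha>\<in>J. gap \<alpha>) \<ge> 0"
    using gap by (intro mult_nonneg_nonneg sum_nonneg) auto
  then show "normalized_scalar_curvature g T p \<le> ?R"
    using eq by linarith
  assume "normalized_scalar_curvature g T p = ?R"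
  then have "(\<Sum>\<alpha>\<in>J. gap \<alpha>) = 0"
    using eq n by simp
  then have gap0: "gap \<alpha> = 0" if "\<alpha> \<in> J" for \<alpha>
    using sum_nonneg_eq_0_iff[OF J, of gap] gap that by simp
  \<comment> \<open>A vanishing gap dominates two nonnegative sums of squares, so both vanish, and
    then so does each of their terms.\<close>
  have z: "diag \<alpha> = 0" "off \<alpha> = 0" if "\<alpha> \<in> J" for \<alpha>
    using le[of \<alpha>] pos[of \<alpha>] gap0[OF that] by linarith+
  have "b \<alpha> i j = 0" if "\<alpha> \<in> J" "i \<in> {1..n}" "j \<in> {1..n}" "i \<noteq> j" for \<alpha> i j
  proof -
    let ?c = "\<lambda>i j. if i = j then 0 else (b \<alpha> i j)\<^sup>2"
    have nonneg: "?c i j \<ge> 0" for i j by simp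
    have "\<forall>i\<in>{1..n}. (\<Sum>j=1..n. ?c i j) = 0"
      using z(2)[OF that(1)] unfolding off_def
      by (rule sum_nonneg_eq_0_iff[OF finite_atLeastAtMost sum_nonneg[OF nonneg], THEN iffD1])
    then have "(\<Sum>j=1..n. ?c i j) = 0"
      using that(2) by blast
    then have "\<forall>j\<in>{1..n}. ?c i j = 0"
      by (rule sum_nonneg_eq_0_iff[OF finite_atLeastAtMost nonneg, THEN iffD1])
    then have "?c i j = 0"
      using that(3) by blast
    then show ?thesis using that(4) by simp
  qed
  moreover have "b \<alpha> i i = 1 / 2 * b \<alpha> n n" if "\<alpha> \<in> J" "i \<in> {1..N}" for \<alpha> i
  proof -
    have "\<forall>i\<in>{1..N}. (b \<alpha> i i - b \<alpha> n n / 2)\<^sup>2 = 0"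
      using z(1)[OF that(1)] unfolding diag_def
      by (rule sum_nonneg_eq_0_iff[OF finite_atLeastAtMost zero_le_power2, THEN iffD1])
    then have "(b \<alpha> i i - b \<alpha> n n / 2)\<^sup>2 = 0"
      using that(2) by blast
    then show ?thesis by simp
  qed
  ultimately show "\<exists>e f. orthonormal_basis (g p) UNIV {1..n} e \<and> orthonormal_basis (gB p) (B p) J f \<and>
        (\<forall>i\<in>{1..n}. \<forall>j\<in>{1..n}. \<forall>\<alpha>\<in>J. i \<noteq> j \<longrightarrow> gB p (\<zeta> p (e i) (e j)) (f \<alpha>) = 0) \<and>
        (\<forall>\<alpha>\<in>J. \<forall>i\<in>{1..N}.
           gB p (\<zeta> p (e i) (e i)) (f \<alpha>) = 1 / 2 * gB p (\<zeta> p (e n) (e n)) (f \<alpha>))"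
    using e(1) f unfolding b_def by blast
qed

lemma normalized_scalar_curvature_le_delta:
  assumes n: "n = CARD('n)" "n = Suc N" "N > 0"
  shows "normalized_scalar_curvature g T p \<le> casorati_delta g J B gB \<zeta> p"
proof -
  let ?C = "casorati g J B gB \<zeta> p" and ?a = "(real n + 1) / (2 * real n)"
  have "dim (UNIV :: (real ^ 'n) set) = n"
    using n(1) by (simp add: dim_UNIV)
  then obtain e where "orthonormal_basis (g p) UNIV {1..n} e"
    using orthonormal_basis_subspace_exists[OF g subspace_UNIV] by auto
  from orthonormal_basis_UNIV_hyperplane(1)[OF this n(1,2)]
  have "span (e ` {1..N}) \<in> hyperplanes"
    unfolding hyperplanes_def using n by simp
  \<comment> \<open>The real infimum is characterised as a greatest lower bound only for a nonempty
    set.\<close>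
  then have ne: "?C ` hyperplanes \<noteq> {}" by blast
  have a: "?a > 0" using n by simp
  \<comment> \<open>Solving for the Casorati curvature of \<open>P\<close> turns the bound for each
    hyperplane into a lower bound of the whole set, whether or not the infimum is attained.\<close>
  have "(normalized_scalar_curvature g T p - 1 / 2 * ?C UNIV) / ?a \<le> Inf (?C ` hyperplanes)"
  proof (rule cInf_greatest[OF ne])
    fix x assume "x \<in> ?C ` hyperplanes"
    then obtain P where P: "P \<in> hyperplanes" "x = ?C P" by blast
    have "normalized_scalar_curvature g T p - 1 / 2 * ?C UNIV \<le> x * ?a"
      using normalized_scalar_curvature_le(1)[OF n P(1)] unfolding P(2) by (simp add: mult.commute)
    then show "(normalized_scalar_curvature g T p - 1 / 2 * ?C UNIV) / ?a \<le> x"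
      using a by (simp only: pos_divide_le_eq)
  qed
  then have "normalized_scalar_curvature g T p - 1 / 2 * ?C UNIV \<le> Inf (?C ` hyperplanes) * ?a"
    using a by (simp only: pos_divide_le_eq)
  then show ?thesis
    unfolding casorati_delta_def n(1)[symmetric] by (simp add: mult.commute)
qed

text \<open>The curvature equals the expression for the span of the first N basis vectors, which is
  at least the one with the infimum; the general inequality closes the circle.\<close>

lemma normalized_scalar_curvature_eq_delta:
  assumes n: "n = CARD('n)" "n = Suc N" "N > 0"
    and e: "orthonormal_basis (g p) UNIV {1..n} e" and f: "orthonormal_basis (gB p) (B p) J f"
    and off: "\<And>i j \<alpha>. i \<in> {1..n} \<Longrightarrow> j \<in> {1..n} \<Longrightarrow> \<alpha> \<in> J \<Longrightarrow> i \<noteq> j \<Longrightarrow>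
      gB p (\<zeta> p (e i) (e j)) (f \<alpha>) = 0"
    and diag: "\<And>\<alpha> i. \<alpha> \<in> J \<Longrightarrow> i \<in> {1..N} \<Longrightarrow>
      gB p (\<zeta> p (e i) (e i)) (f \<alpha>) = 1 / 2 * gB p (\<zeta> p (e n) (e n)) (f \<alpha>)"
  shows "normalized_scalar_curvature g T p = casorati_delta g J B gB \<zeta> p"
proof (rule antisym[OF normalized_scalar_curvature_le_delta[OF n]])
  let ?C = "casorati g J B gB \<zeta> p" and ?P = "span (e ` {1..N})"
  have P: "?P \<in> hyperplanes"
    using orthonormal_basis_UNIV_hyperplane(1)[OF e n(1,2)] n by (auto simp: hyperplanes_def)
  have "(\<Sum>\<alpha>\<in>J. (real n + 1) / 2 * ((\<Sum>i=1..n. \<Sum>j=1..n. (gB p (\<zeta> p (e i) (e j)) (f \<alpha>))\<^sup>2)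
        + (\<Sum>i=1..N. \<Sum>j=1..N. (gB p (\<zeta> p (e i) (e j)) (f \<alpha>))\<^sup>2))
      - (\<Sum>i=1..n. gB p (\<zeta> p (e i) (e i)) (f \<alpha>))\<^sup>2) = 0"
    by (intro sum.neutral ballI trace_square_gap_eq_0[OF n(2)] off diag)
  then have "normalized_scalar_curvature g T p =
      1 / 2 * ?C UNIV + (real n + 1) / (2 * real n) * ?C ?P"
    using casorati_gap[OF e f n] by simp
  moreover have "(real n + 1) / (2 * real n) * Inf (?C ` hyperplanes) \<le>
      (real n + 1) / (2 * real n) * ?C ?P"
    by (intro mult_left_mono cInf_lower bdd_below_casorati imageI P) simp
  ultimately show "casorati_delta g J B gB \<zeta> p \<le> normalized_scalar_curvature g T p"
    unfolding casorati_delta_def n(1)[symmetric] by linarith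
qed

end

section \<open>From manifold and bundle to the pointwise setting\<close>

lemma fibre_orthonormal_basis_exists:
  assumes B: "riemannian_vector_bundle M A I B F gB" and p: "p \<in> topspace M"
  shows "\<exists>f. orthonormal_basis (gB p) (B p) I f"
proof -
  have b: "vector_bundle M A I B F" and gB: "inner_product_on (B p) (gB p)"
    using B p by (auto simp: riemannian_vector_bundle_def)
  have sub: "subspace (B p)" and I: "finite I" and F: "(\<Union>(U, s)\<in>F. U) = topspace M"
    and basis: "\<forall>(U, s)\<in>F. \<forall>p\<in>U. inj_on (\<lambda>\<alpha>. s \<alpha> p) I \<and> independent ((\<lambda>\<alpha>. s \<alpha> p) ` I) \<and>
      span ((\<lambda>\<alpha>. s \<alpha> p) ` I) = B p"
    using b p by (simp_all add: vector_bundle_def case_prod_beta)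
  obtain U s where U: "(U, s) \<in> F" "p \<in> U"
    using p unfolding F[symmetric] by blast
  have s: "inj_on (\<lambda>\<alpha>. s \<alpha> p) I" "independent ((\<lambda>\<alpha>. s \<alpha> p) ` I)" "span ((\<lambda>\<alpha>. s \<alpha> p) ` I) = B p"
    using bspec[OF basis U(1)] U(2) by simp_all
  have "(\<lambda>\<alpha>. s \<alpha> p) ` I \<subseteq> B p"
    using span_superset[of "(\<lambda>\<alpha>. s \<alpha> p) ` I"] unfolding s(3) .
  \<comment> \<open>Gram-Schmidt is applied to a local frame at \<open>p\<close>; its injectivity
    matches the cardinality of the basis with that of \<open>I\<close>.\<close>
  then show ?thesis
    using orthonormal_basis_exists[OF sub gB finite_imageI[OF I] s(2) _ I card_image[OF s(1), symmetric]]
    unfolding s(3) by blast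
qed

theorem theorem4p5:
  fixes M :: "'a topology"
    and A :: "('a, 'n::finite) chart set"
    and g :: "'a \<Rightarrow> real ^ 'n \<Rightarrow> real ^ 'n \<Rightarrow> real"
    and B :: "'a \<Rightarrow> 'b::real_vector set"
    and F :: "('a, 'b) frame set"
    and gB :: "'a \<Rightarrow> 'b \<Rightarrow> 'b \<Rightarrow> real"
    and \<zeta> :: "'a \<Rightarrow> real ^ 'n \<Rightarrow> real ^ 'n \<Rightarrow> 'b"
    and T :: "'a \<Rightarrow> real ^ 'n \<Rightarrow> real ^ 'n \<Rightarrow> real ^ 'n \<Rightarrow> real ^ 'n \<Rightarrow> real"
    and n m :: nat
  assumes n: "n = CARD('n)" "n \<ge> 3"
    and m: "m \<ge> n"
    and M: "riemannian_manifold M A g"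
    and B: "riemannian_vector_bundle M A {n+1..m} B F gB"
    and \<zeta>: "symmetric_12_tensor_field M A {n+1..m} B F \<zeta>"
    and T: "curvature_like M A T"
    and gauss: "algebraic_gauss_equation M A gB \<zeta> T"
  shows "\<forall>p\<in>topspace M.
     normalized_scalar_curvature g T p \<le> casorati_delta g {n+1..m} B gB \<zeta> p \<and>
     ((\<exists>P\<in>hyperplanes. casorati g {n+1..m} B gB \<zeta> p P =
                         Inf (casorati g {n+1..m} B gB \<zeta> p ` hyperplanes)) \<longrightarrow>
      (normalized_scalar_curvature g T p = casorati_delta g {n+1..m} B gB \<zeta> p \<longleftrightarrow>
       (\<exists>e f. orthonormal_basis (g p) UNIV {1..n} e \<and>
              orthonormal_basis (gB p) (B p) {n+1..m} f \<and>
              (\<forall>i\<in>{1..n}. \<forall>j\<in>{1..n}. \<forall>\<alpha>\<in>{n+1..m}. i \<noteq> j \<longrightarrow> gB p (\<zeta> p (e i) (e j)) (f \<alpha>) = 0) \<and>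
              (\<forall>\<alpha>\<in>{n+1..m}. \<forall>i\<in>{1..n-1}.
                 gB p (\<zeta> p (e i) (e i)) (f \<alpha>) = 1 / 2 * gB p (\<zeta> p (e n) (e n)) (f \<alpha>)))))"
proof
  fix p assume p: "p \<in> topspace M"
  define N where "N = n - 1"
  have N: "n = Suc N" "N > 0" using n(2) by (auto simp: N_def)
  let ?J = "{n+1..m}"
  have sm: "smooth_manifold M A"
    using M by (simp add: riemannian_manifold_def)
  interpret gauss_point g B gB \<zeta> T p ?J
  proof
    show "inner_product_on UNIV (g p)"
      using M p by (simp add: riemannian_manifold_def riemannian_metric_def)
    show "subspace (B p)" "inner_product_on (B p) (gB p)"
      using B p by (simp_all add: riemannian_vector_bundle_def vector_bundle_def)
    show "bilinear (\<zeta> p)" "\<zeta> p x y = \<zeta> p y x" "\<zeta> p x y \<in> B p" for x y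
      using \<zeta> p unfolding symmetric_12_tensor_field_def by blast+
    show "\<exists>f. orthonormal_basis (gB p) (B p) ?J f"
      by (rule fibre_orthonormal_basis_exists[OF B p])
  qed (auto intro: algebraic_gauss_equation_pointwise[OF sm p gauss])
  let ?E = "\<exists>e f. orthonormal_basis (g p) UNIV {1..n} e \<and> orthonormal_basis (gB p) (B p) ?J f \<and>
    (\<forall>i\<in>{1..n}. \<forall>j\<in>{1..n}. \<forall>\<alpha>\<in>?J. i \<noteq> j \<longrightarrow> gB p (\<zeta> p (e i) (e j)) (f \<alpha>) = 0) \<and>
    (\<forall>\<alpha>\<in>?J. \<forall>i\<in>{1..n-1}. gB p (\<zeta> p (e i) (e i)) (f \<alpha>) = 1 / 2 * gB p (\<zeta> p (e n) (e n)) (f \<alpha>))"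
  \<comment> \<open>Attainment at \<open>P\<close> turns equality with \<open>casorati_delta\<close>
    into equality in the bound for \<open>P\<close> itself.\<close>
  have "?E" if P: "P \<in> hyperplanes"
      and attained: "casorati g ?J B gB \<zeta> p P = Inf (casorati g ?J B gB \<zeta> p ` hyperplanes)"
      and eq: "normalized_scalar_curvature g T p = casorati_delta g ?J B gB \<zeta> p" for P
    by (rule normalized_scalar_curvature_le(2)[OF n(1) N P, unfolded N_def])
      (use eq in \<open>simp only: casorati_delta_def n(1)[symmetric] attained\<close>)
  moreover have "normalized_scalar_curvature g T p = casorati_delta g ?J B gB \<zeta> p" if ?E
  proof -
    from that obtain e f where ef: "orthonormal_basis (g p) UNIV {1..n} e"
        "orthonormal_basis (gB p) (B p) ?J f"
        "\<forall>i\<in>{1..n}. \<forall>j\<in>{1..n}. \<forall>\<alpha>\<in>?J. i \<noteq> j \<longrightarrow> gB p (\<zeta> p (e i) (e j)) (f \<alpha>) = 0"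
        "\<forall>\<alpha>\<in>?J. \<forall>i\<in>{1..N}. gB p (\<zeta> p (e i) (e i)) (f \<alpha>) = 1 / 2 * gB p (\<zeta> p (e n) (e n)) (f \<alpha>)"
      unfolding N_def by blast
    show ?thesis
      by (rule normalized_scalar_curvature_eq_delta[OF n(1) N ef(1,2)]) (use ef(3,4) in blast)+
  qed
  ultimately show "normalized_scalar_curvature g T p \<le> casorati_delta g ?J B gB \<zeta> p \<and>
     ((\<exists>P\<in>hyperplanes. casorati g ?J B gB \<zeta> p P = Inf (casorati g ?J B gB \<zeta> p ` hyperplanes)) \<longrightarrow>
      (normalized_scalar_curvature g T p = casorati_delta g ?J B gB \<zeta> p \<longleftrightarrow> ?E))"
    by (intro conjI normalized_scalar_curvature_le_delta[OF n(1) N] impI iffI) blast+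
qed

end
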